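(* Let $\Pi=(t_k)_{k\in\mathbb{Z}}$ be a strictly increasing sequence of real numbers with $\Delta_k=t_{k+1}-t_k=1$ for every $k\in\mathbb{Z}$, and let $\chi$ be a nonlinear kernel of starred type with data $(L,\psi,\alpha,\beta)$ relative to $\Pi$. Let $\varphi$ be a convex $\varphi$-function, and suppose that there is a convex $\varphi$-function $\eta$ such that for every $\lambda\in(0,1)$ there is a constant $C_\lambda\in(0,1)$ with $\varphi(C_\lambda\psi(u))\le\eta(\lambda u)$ for every $u\in\mathbb{R}^+_0$. Suppose also that for any fixed $0<\gamma<1$ there are positive constants $M_3,\gamma_0$ (depending on $\gamma$ and $L$) such that $$w\int_{|\ln y|>\frac{1}{w^\gamma}}L(y^w)\frac{dy}{y}\le M_3\,w^{-\gamma_0}$$ for all sufficiently large $w>0$. Then, for every $0<\gamma<1$ with corresponding $\gamma_0$, and for any $f\in L^{\varphi+\eta}_\mu(\mathbb{R}^+)\cap Lip_{\eta,\mu}(\nu)$, $0<\nu\le1$, there exist $C>0$ and $c>0$ such that $$I^\varphi_\mu\big[c\,(K^\chi_wf-f)\big]\le C\,w^{-l}$$ for sufficiently large $w>0$, with $l:=\min\{\gamma\nu,\gamma_0,\alpha\}$.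
   Context: Notation: $\mathbb{R}^+=(0,\infty)$, $\mathbb{R}^+_0=[0,\infty)$; $\mu$ is the logarithmic (Haar) measure $\mu(A)=\int_A \frac{dt}{t}$ on $\mathbb{R}^+$, and $L^1_\mu(\mathbb{R}^+)$ the corresponding Lebesgue space. A $\varphi$-function is a function $\varphi:\mathbb{R}^+_0\to\mathbb{R}^+_0$ that is non-decreasing and continuous, with $\varphi(0)=0$, $\varphi(u)>0$ for $u>0$, and $\varphi(u)\to+\infty$ as $u\to+\infty$. The associated modular is $I^\varphi_\mu[f]:=\int_0^{+\infty}\varphi(|f(x)|)\frac{dx}{x}$ for measurable $f:\mathbb{R}^+\to\mathbb{R}$, and the Mellin-Orlicz space is $L^\varphi_\mu(\mathbb{R}^+):=\{f \text{ measurable}: I^\varphi_\mu[\lambda f]<+\infty\text{ for some }\lambda>0\}$; $L^{\varphi+\eta}_\mu(\mathbb{R}^+)$ is the Mellin-Orlicz space generated by the $\varphi$-function $\varphi+\eta$. The log-modulus of smoothness with respect to $I^\eta_\mu$ is $$\widetilde\omega_{\eta,\mu}(f,\delta'):=\sup_{|\ln t|\le\delta'}I^\eta_\mu[f(\cdot\,t)-f(\cdot)]=\sup_{|\ln t|\le\delta'}\int_0^{+\infty}\eta(|f(st)-f(s)|)\frac{ds}{s},\qquad\delta'>0.$$ For $0<\nu\le1$, the log-Hölderian class is $$Lip_{\eta,\mu}(\nu):=\{f\in L^\eta_\mu(\mathbb{R}^+):\ \exists\lambda>0,\ \widetilde\omega_{\eta,\mu}(\lambda f,\delta')=\mathcal{O}(\delta'^{\,\nu})\text{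 as }\delta'\to0^+\}.$$ A nonlinear kernel of starred type with data $(L,\psi,\alpha,\beta)$ relative to $\Pi$, where $L:\mathbb{R}^+\to\mathbb{R}^+_0$ is measurable, $\psi:\mathbb{R}^+_0\to\mathbb{R}^+_0$ is non-decreasing and continuous with $\psi(0)=0$, and $\alpha,\beta>0$, is a function $\chi:\mathbb{R}^+\times\mathbb{R}\to\mathbb{R}$ such that: (1) $(\chi(e^{-t_k}x^w,u))_k\in\ell^1(\mathbb{Z})$ for every $x\in\mathbb{R}^+$, $u\in\mathbb{R}$, $w>0$; (2) $\chi(x,0)=0$ for every $x\in\mathbb{R}^+$; (3) $|\chi(x,u)-\chi(x,v)|\le L(x)\,\psi(|u-v|)$ for every $x\in\mathbb{R}^+$, $u,v\in\mathbb{R}$; (4* ) $\displaystyle\mathcal{T}_w(x):=\sup_{u\neq0}\Big|\frac1u\sum_{k\in\mathbb{Z}}\chi(e^{-t_k}x^w,u)-1\Big|=\mathcal{O}(w^{-\alpha})$ as $w\to+\infty$, uniformly with respect to $x\in\mathbb{R}^+$; (5) $L\in L^1_\mu(\mathbb{R}^+)$ and $L$ is bounded; (6) $M_{\beta,\Pi}(L):=\sup_{x\in\mathbb{R}^+}\sum_{k\in\mathbb{Z}}L(e^{-t_k}x)\,|\ln x-t_k|^\beta<+\infty$. For $w>0$ and a locally integrable $f:\mathbb{R}^+\to\mathbb{R}$ for which the series converges for every $x$, the nonlinear exponential Kantorovich sampling operator is $$(K^\chi_w f)(x):=\sum_{k\in\mathbb{Z}}\chi\Big(e^{-t_k}x^w,\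 \frac{w}{\Delta_k}\int_{t_k/w}^{t_{k+1}/w}f(e^u)\,du\Big),\qquad x\in\mathbb{R}^+.$$ *)

theory Defs
  imports "HOL-Analysis.Analysis"
begin

text \<open>
  Functions on the positive half-line are rendered as functions on all of \<^typ>\<open>real\<close>; only their
  values at positive (for \<open>\<phi>\<close>, \<open>\<eta>\<close>, \<open>\<psi>\<close>: non-negative) arguments play a role.
  Measurable means Lebesgue measurable.  Quantities that may be infinite (modulars, suprema,
  series of non-negative terms) take values in \<^typ>\<open>ennreal\<close>.
\<close>

definition log_measure :: "real measure" where
  "log_measure = density (lebesgue_on {0<..}) (\<lambda>x. ennreal (1 / x))"

definition phi_function :: "(real \<Rightarrow> real) \<Rightarrow> bool" where
  "phi_function \<phi> \<longleftrightarrow>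
     mono_on {0..} \<phi> \<and> continuous_on {0..} \<phi> \<and> \<phi> 0 = 0 \<and> (\<forall>u>0. \<phi> u > 0) \<and>
     filterlim \<phi> at_top at_top"

definition modular :: "(real \<Rightarrow> real) \<Rightarrow> (real \<Rightarrow> real) \<Rightarrow> ennreal" where
  "modular \<phi> f = (\<integral>\<^sup>+x. ennreal (\<phi> \<bar>f x\<bar>) \<partial>log_measure)"

definition mellin_orlicz :: "(real \<Rightarrow> real) \<Rightarrow> (real \<Rightarrow> real) set" where
  "mellin_orlicz \<phi> =
     {f \<in> borel_measurable log_measure. \<exists>a>0. modular \<phi> (\<lambda>x. a * f x) < \<infinity>}"

definition log_modulus :: "(real \<Rightarrow> real) \<Rightarrow> (real \<Rightarrow> real) \<Rightarrow> real \<Rightarrow> ennreal" where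
  "log_modulus \<eta> f \<delta> = (SUP t\<in>{t. 0 < t \<and> \<bar>ln t\<bar> \<le> \<delta>}. modular \<eta> (\<lambda>s. f (s * t) - f s))"

definition log_lip :: "(real \<Rightarrow> real) \<Rightarrow> real \<Rightarrow> (real \<Rightarrow> real) set" where
  "log_lip \<eta> \<nu> =
     {f \<in> mellin_orlicz \<eta>.
        \<exists>a>0. \<exists>M. \<forall>\<^sub>F \<delta> in at_right 0. log_modulus \<eta> (\<lambda>x. a * f x) \<delta> \<le> ennreal (M * \<delta> powr \<nu>)}"

definition kernel_defect ::
    "(int \<Rightarrow> real) \<Rightarrow> (real \<Rightarrow> real \<Rightarrow> real) \<Rightarrow> real \<Rightarrow> real \<Rightarrow> ennreal" where
  "kernel_defect t \<kappa> w x =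
     (SUP u\<in>- {0}. ennreal \<bar>1 / u * (\<Sum>\<^sub>\<infinity>k. \<kappa> (exp (- t k) * x powr w) u) - 1\<bar>)"

definition discrete_moment :: "(int \<Rightarrow> real) \<Rightarrow> real \<Rightarrow> (real \<Rightarrow> real) \<Rightarrow> ennreal" where
  "discrete_moment t \<beta> L =
     (SUP x\<in>{0<..}. \<Sum>\<^sub>\<infinity>k. ennreal (L (exp (- t k) * x) * \<bar>ln x - t k\<bar> powr \<beta>))"

text \<open>
  Non-negativity of \<open>\<psi>\<close> on the half-line follows from monotonicity and \<open>\<psi> 0 = 0\<close>; likewise for
  \<open>\<phi>\<close> above.  No measurability of \<open>\<kappa>\<close> is required.
\<close>

definition starred_kernel ::
    "(int \<Rightarrow> real) \<Rightarrow> (real \<Rightarrow> real) \<Rightarrow> (real \<Rightarrow> real) \<Rightarrow> real \<Rightarrow> real \<Rightarrow>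
     (real \<Rightarrow> real \<Rightarrow> real) \<Rightarrow> bool" where
  "starred_kernel t L \<psi> \<alpha> \<beta> \<kappa> \<longleftrightarrow>
     L \<in> borel_measurable log_measure \<and> (\<forall>x>0. 0 \<le> L x) \<and>
     mono_on {0..} \<psi> \<and> continuous_on {0..} \<psi> \<and> \<psi> 0 = 0 \<and>
     0 < \<alpha> \<and> 0 < \<beta> \<and>
     (\<forall>x>0. \<forall>u. \<forall>w>0. (\<lambda>k. \<bar>\<kappa> (exp (- t k) * x powr w) u\<bar>) summable_on UNIV) \<and>
     (\<forall>x>0. \<kappa> x 0 = 0) \<and>
     (\<forall>x>0. \<forall>u v. \<bar>\<kappa> x u - \<kappa> x v\<bar> \<le> L x * \<psi> \<bar>u - v\<bar>) \<and>
     (\<exists>M. \<forall>\<^sub>F w in at_top. \<forall>x>0. kernel_defect t \<kappa> w x \<le> ennreal (M * w powr (- \<alpha>))) \<and>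
     integrable log_measure L \<and> bounded (L ` {0<..}) \<and>
     discrete_moment t \<beta> L < \<infinity>"

definition exp_kantorovich ::
    "(int \<Rightarrow> real) \<Rightarrow> (real \<Rightarrow> real \<Rightarrow> real) \<Rightarrow> real \<Rightarrow> (real \<Rightarrow> real) \<Rightarrow> real \<Rightarrow> real" where
  "exp_kantorovich t \<kappa> w f x =
     (\<Sum>\<^sub>\<infinity>k. \<kappa> (exp (- t k) * x powr w)
        (w / (t (k + 1) - t k) * (LINT u:{t k / w..t (k + 1) / w}|lebesgue. f (exp u))))"

definition kernel_tail_decay :: "(real \<Rightarrow> real) \<Rightarrow> real \<Rightarrow> real \<Rightarrow> bool" where
  "kernel_tail_decay L \<gamma> \<gamma>\<^sub>0 \<longleftrightarrow>
     0 < \<gamma>\<^sub>0 \<and>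
     (\<exists>M>0. \<forall>\<^sub>F w in at_top.
        ennreal w * (\<integral>\<^sup>+y\<in>{y. 1 / w powr \<gamma> < \<bar>ln y\<bar>}. ennreal (L (y powr w)) \<partial>log_measure)
          \<le> ennreal (M * w powr (- \<gamma>\<^sub>0)))"

end

theory Submission
  imports Defs
begin

text \<open>
  In the additive coordinate \<open>v = ln x\<close>, put \<open>F v = f (exp v)\<close>.  The defect \<open>\<T>\<^sub>w\<close> contributes at
  most \<open>K w\<^sup>-\<^sup>\<alpha> \<bar>f x\<bar>\<close>, and convexity of \<open>\<phi>\<close> turns the factor \<open>w\<^sup>-\<^sup>\<alpha>\<close> into a factor of the modular.
  The remaining difference is \<open>\<Sum>\<^sub>k (\<kappa> (\<cdot>, m\<^sub>k) - \<kappa> (\<cdot>, f x))\<close>, where \<open>m\<^sub>k\<close> is the \<open>k\<close>-th mean of \<open>F\<close>;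
  Jensen's inequality for the weights \<open>L (exp (w v - t\<^sub>k)) / M\<close>, the comparison of \<open>\<phi> \<circ> \<psi>\<close> with \<open>\<eta>\<close>, and
  Jensen's inequality for the means bound it by a double integral of \<open>\<eta> (\<lambda> \<bar>F u - F v\<bar>)\<close>.
  Writing \<open>u = t\<^sub>k / w + r\<close> and inserting \<open>F (v + r)\<close> makes one part depend on the shift
  \<open>z = v - t\<^sub>k / w\<close> only, weighted by \<open>w L (exp (w z))\<close>: for \<open>\<bar>z\<bar> \<le> w\<^sup>-\<^sup>\<gamma>\<close> the log-Hoelder condition
  applies, for larger \<open>\<bar>z\<bar>\<close> the tail hypothesis.  The other part is a shift by \<open>r \<le> 1 / w\<close>.
\<close>

section \<open>Logarithmic measure in additive coordinates\<close>

text \<open>The integral of \<open>1 / x\<close> from \<open>exp l\<close> to \<open>exp u\<close>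
  is \<open>u - l\<close>, the length of the box, and agreement on boxes identifies Lebesgue
  measure.\<close>

lemma distr_ln_log_density:
  "distr (density lborel (\<lambda>x. indicator {0<..} x * ennreal (1 / x))) borel ln = (lborel :: real measure)"
proof (rule lborel_eqI[symmetric])
  fix l u :: real
  assume lu: "\<And>b. b \<in> Basis \<Longrightarrow> l \<bullet> b \<le> u \<bullet> b"
  let ?D = "density lborel (\<lambda>x::real. indicator {0<..} x * ennreal (1 / x))"
  have "l \<le> u" using lu by simp
  have "emeasure (distr ?D borel ln) (box l u) = emeasure ?D (ln -` {l<..<u})"
    by (subst emeasure_distr[of ln ?D borel]) (simp_all add: box_real)
  also have "\<dots> = (\<integral>\<^sup>+x. indicator {0<..} x * ennreal (1 / x) * indicator (ln -` {l<..<u}) x \<partial>lborel)"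
    using measurable_sets[of ln borel borel "{l<..<u}"] by (subst emeasure_density) simp_all
  \<comment> \<open>The two endpoints form a null set; the fundamental theorem below takes a closed
    interval.\<close>
  also have "\<dots> = (\<integral>\<^sup>+x. ennreal (1 / x) * indicator {exp l .. exp u} x \<partial>lborel)"
  proof (rule nn_integral_cong_AE)
    have *: "indicator {0<..} x * ennreal (1 / x) * indicator (ln -` {l<..<u}) x
        = ennreal (1 / x) * indicator {exp l .. exp u} x" if "x \<noteq> exp l" "x \<noteq> exp u" for x
    proof -
      have iff: "0 < x \<and> l < ln x \<and> ln x < u \<longleftrightarrow> exp l \<le> x \<and> x \<le> exp u"
      proof
        assume "0 < x \<and> l < ln x \<and> ln x < u"
        then show "exp l \<le> x \<and> x \<le> exp u"
          using ln_ge_iff[of x l] ln_le_cancel_iff[of x "exp u"] by simp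
      next
        assume a: "exp l \<le> x \<and> x \<le> exp u"
        then have "0 < x" using exp_gt_zero[of l] by linarith
        with a that show "0 < x \<and> l < ln x \<and> ln x < u"
          using ln_less_cancel_iff[of "exp l" x] ln_less_cancel_iff[of x "exp u"] by simp
      qed
      then show ?thesis by (auto split: split_indicator)
    qed
    show "AE x in lborel. indicator {0<..} x * ennreal (1 / x) * indicator (ln -` {l<..<u}) x
        = ennreal (1 / x) * indicator {exp l .. exp u} x"
      using AE_lborel_singleton[of "exp l"] AE_lborel_singleton[of "exp u"]
      by eventually_elim (rule *)
  qed
  also have "\<dots> = ennreal (ln (exp u) - ln (exp l))"
  proof (rule nn_integral_FTC_Icc)
    fix x assume "x \<in> {exp l..exp u}"
    then have "0 < x" using exp_gt_zero[of l] by (meson atLeastAtMost_iff less_le_trans)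
    then show "(ln has_real_derivative 1 / x) (at x)" "0 \<le> 1 / x"
      by (auto intro!: derivative_eq_intros simp: inverse_eq_divide)
  qed (use \<open>l \<le> u\<close> in auto)
  finally show "emeasure (distr ?D borel ln) (box l u) = ennreal (\<Prod>b\<in>Basis. (u - l) \<bullet> b)"
    by simp
qed simp

text \<open>Since \<open>g\<close> is Borel, the completed and restricted measure can be exchanged
  for \<open>lborel\<close> with an indicator; the push-forward under \<open>ln\<close> then
  performs the substitution \<open>v = ln x\<close>.\<close>

lemma nn_integral_log_measure_ln:
  fixes g :: "real \<Rightarrow> ennreal"
  assumes [measurable]: "g \<in> borel_measurable borel"
  shows "(\<integral>\<^sup>+x. g (ln x) \<partial>log_measure) = (\<integral>\<^sup>+v. g v \<partial>lborel)"
proof -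
  have m: "(\<lambda>x. g (ln x)) \<in> borel_measurable (lebesgue_on {0<..})"
    by (intro measurable_restrict_space1 measurable_completion) measurable
  have d: "(\<lambda>x. ennreal (1 / x)) \<in> borel_measurable (lebesgue_on {0<..})"
    by (intro measurable_restrict_space1 measurable_completion) measurable
  have "(\<integral>\<^sup>+x. g (ln x) \<partial>log_measure)
      = (\<integral>\<^sup>+x. ennreal (1 / x) * g (ln x) \<partial>lebesgue_on {0<..})"
    unfolding log_measure_def by (rule nn_integral_density[OF d m])
  also have "\<dots> = (\<integral>\<^sup>+x. ennreal (1 / x) * g (ln x) * indicator {0<..} x \<partial>lborel)"
    by (subst nn_integral_restrict_space) (auto simp: nn_integral_completion)
  also have "\<dots> = (\<integral>\<^sup>+x. indicator {0<..} x * ennreal (1 / x) * g (ln x) \<partial>lborel)"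
    by (intro nn_integral_cong) (auto simp: ac_simps)
  also have "\<dots> = (\<integral>\<^sup>+x. g (ln x) \<partial>density lborel (\<lambda>x. indicator {0<..} x * ennreal (1 / x)))"
    by (rule nn_integral_density[symmetric]) measurable
  also have "\<dots> = (\<integral>\<^sup>+v. g v \<partial>distr (density lborel (\<lambda>x. indicator {0<..} x * ennreal (1 / x))) borel ln)"
    by (rule nn_integral_distr[symmetric]) auto
  finally show ?thesis by (simp add: distr_ln_log_density)
qed

text \<open>The density \<open>1 / x\<close> is strictly positive on the half-line, so it creates no
  new null sets there.\<close>

lemma AE_log_measure_iff:
  "(AE x in log_measure. P x) \<longleftrightarrow> (AE x in lborel. 0 < x \<longrightarrow> P x)"
proof -
  have d: "(\<lambda>x::real. ennreal (1 / x)) \<in> borel_measurable (lebesgue_on {0<..})"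
    by (intro measurable_restrict_space1 measurable_completion) measurable
  have "(AE x in log_measure. P x) \<longleftrightarrow> (AE x in lborel. x \<in> {0<..} \<longrightarrow> 0 < ennreal (1 / x) \<longrightarrow> P x)"
    unfolding log_measure_def
    by (subst AE_density[OF d], subst AE_restrict_space_iff) (auto simp: AE_completion_iff)
  also have "\<dots> \<longleftrightarrow> (AE x in lborel. 0 < x \<longrightarrow> P x)"
    by (intro AE_cong) (auto simp: zero_less_divide_iff)
  finally show ?thesis .
qed

lemma AE_log_measure_pos: "AE x in log_measure. 0 < x"
  by (simp add: AE_log_measure_iff)

text \<open>\<open>P\<close> need not be measurable, so its exceptional set is enclosed in a Borel
  null set \<open>N\<close>; by the change of variables the preimage of \<open>N\<close> under
  \<open>ln\<close> has measure zero.\<close>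

lemma AE_log_measure_ln:
  assumes "AE v in lborel. P v"
  shows "AE x in log_measure. P (ln x)"
proof -
  from assms obtain N where N: "{v \<in> space lborel. \<not> P v} \<subseteq> N" "N \<in> null_sets lborel"
    by (auto simp: eventually_ae_filter)
  then have [measurable]: "N \<in> sets borel" by auto
  have m: "(\<lambda>x. indicator N (ln x) :: ennreal) \<in> borel_measurable log_measure"
    unfolding log_measure_def measurable_density_eq1
    by (intro measurable_restrict_space1 measurable_completion) measurable
  have "(\<integral>\<^sup>+x. indicator N (ln x) \<partial>log_measure) = (\<integral>\<^sup>+v. indicator N v \<partial>lborel)"
    by (rule nn_integral_log_measure_ln) measurable
  also have "\<dots> = 0" using N(2) by (simp add: nn_integral_indicator null_setsD1)
  finally have "AE x in log_measure. indicator N (ln x) = (0::ennreal)"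
    using nn_integral_0_iff_AE[OF m] by simp
  then show ?thesis
    by eventually_elim (use N in \<open>auto split: split_indicator_asm\<close>)
qed

text \<open>The change of variables, read for the function sending \<open>v\<close> to the indicator
  of \<open>N\<close> at \<open>exp v\<close>, shows that the preimage of a Borel null set under
  \<open>exp\<close> is null.\<close>

lemma AE_lborel_exp:
  assumes "AE x in log_measure. P x"
  shows "AE v in lborel. P (exp v)"
proof -
  have "AE x in lborel. 0 < x \<longrightarrow> P x" using assms by (simp add: AE_log_measure_iff)
  then obtain N where N: "{x. 0 < x \<and> \<not> P x} \<subseteq> N" "N \<in> null_sets lborel"
    by (auto simp: eventually_ae_filter)
  then have [measurable]: "N \<in> sets borel" by auto
  have "AE x in lborel. x \<notin> N" by (rule AE_not_in[OF N(2)])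
  then have nx: "AE x in log_measure. x \<notin> N" unfolding AE_log_measure_iff by eventually_elim simp
  have "(\<integral>\<^sup>+v. indicator N (exp v) \<partial>lborel) = (\<integral>\<^sup>+x. indicator N (exp (ln x)) \<partial>log_measure)"
    by (rule nn_integral_log_measure_ln[symmetric]) measurable
  also have "\<dots> = (\<integral>\<^sup>+x. 0 \<partial>log_measure)"
  proof (rule nn_integral_cong_AE)
    show "AE x in log_measure. indicator N (exp (ln x)) = (0::ennreal)"
      using nx AE_log_measure_pos by eventually_elim simp
  qed
  finally have "(\<integral>\<^sup>+v. indicator N (exp v) \<partial>lborel) = (0::ennreal)" by simp
  then have "AE v in lborel. indicator N (exp v) = (0::ennreal)"
    by (subst (asm) nn_integral_0_iff_AE) auto
  then show ?thesis
  proof eventually_elim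
    case (elim v)
    then have "exp v \<notin> N" by (simp split: split_indicator_asm)
    then show ?case using N(1) exp_gt_zero[of v] by blast
  qed
qed

text \<open>A Lebesgue measurable \<open>F\<close> does not make \<open>F (u + z)\<close> measurable for the product of the Lebesgue
  \<open>\<sigma>\<close>-algebras; with a Borel representative Tonelli applies.\<close>

lemma borel_representative_exp:
  assumes "f \<in> borel_measurable log_measure"
  obtains F :: "real \<Rightarrow> real" where "F \<in> borel_measurable borel" "AE v in lborel. F v = f (exp v)"
proof -
  have "f \<in> borel_measurable (lebesgue_on {0<..})"
    using assms by (simp add: log_measure_def)
  then have "(\<lambda>x. if x \<in> {0<..} then f x else 0) \<in> borel_measurable lebesgue"
    by (subst borel_measurable_if) simp_all
  then obtain g where g: "g \<in> borel_measurable lborel"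
    "AE x in lborel. (if x \<in> {0<..} then f x else 0) = g x"
    using completion_ex_borel_measurable_real[of "\<lambda>x. if x \<in> {0<..} then f x else 0" lborel] by auto
  then have "AE x in log_measure. f x = g x"
    unfolding AE_log_measure_iff by eventually_elim (auto split: if_splits)
  from AE_lborel_exp[OF this] have "AE v in lborel. g (exp v) = f (exp v)"
    by eventually_elim simp
  moreover have "(\<lambda>v. g (exp v)) \<in> borel_measurable borel" using g(1) by measurable
  ultimately show ?thesis using that by blast
qed

text \<open>Again a Borel null set encloses the exceptional set. Translations of \<open>F\<close>
  and dilations of the kernel rely on this.\<close>

lemma AE_lborel_affine:
  fixes c d :: real
  assumes "AE v in lborel. P v" "c \<noteq> 0"
  shows "AE v in lborel. P (d + c * v)"
proof -
  from assms obtain N where N: "{v \<in> space lborel. \<not> P v} \<subseteq> N" "N \<in> null_sets lborel"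
    by (auto simp: eventually_ae_filter)
  then have [measurable]: "N \<in> sets borel" by auto
  have "AE v in lborel. d + c * v \<notin> N"
    by (rule AE_borel_affine) (use assms AE_not_in[OF N(2)] in auto)
  then show ?thesis by eventually_elim (use N in auto)
qed

text \<open>Completeness of Lebesgue measure: the preimages of a Borel set under \<open>F\<close>
  and \<open>g\<close> differ only by a null set.\<close>

lemma lebesgue_measurable_AE_eq:
  fixes F g :: "real \<Rightarrow> real"
  assumes [measurable]: "F \<in> borel_measurable borel" and ae: "AE v in lborel. F v = g v"
  shows "g \<in> borel_measurable lebesgue"
proof (rule measurableI)
  fix A :: "real set" assume [measurable]: "A \<in> sets borel"
  have "F -` A \<inter> space lebesgue \<in> sets lebesgue"
    using measurable_sets[OF measurable_completion[of F lborel borel], of A] assms(1) by simp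
  moreover have "AE v in lebesgue. v \<in> g -` A \<inter> space lebesgue \<longleftrightarrow> v \<in> F -` A \<inter> space lebesgue"
    using ae by (intro AE_completion) (auto elim: eventually_mono)
  ultimately show "g -` A \<inter> space lebesgue \<in> sets lebesgue"
    by (intro completion.in_sets_AE[of "F -` A \<inter> space lebesgue" "g -` A \<inter> space lebesgue" lborel])
      (auto elim: eventually_mono)
qed auto

text \<open>The means in the operator are Lebesgue integrals of \<open>f (exp u)\<close>; this
  computes them from a Borel representative.\<close>

lemma set_integral_lebesgue_AE_eq:
  fixes F g :: "real \<Rightarrow> real"
  assumes F: "F \<in> borel_measurable borel" and ae: "AE v in lborel. F v = g v"
  shows "(LINT u:{a..b}|lebesgue. g u) = (LINT u:{a..b}|lborel. F u)"
proof -
  have "g \<in> borel_measurable lebesgue" "F \<in> borel_measurable lebesgue"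
    using lebesgue_measurable_AE_eq[OF F ae] measurable_completion[of F lborel borel] F by auto
  then have m: "(\<lambda>x. indicat_real {a..b} x *\<^sub>R g x) \<in> borel_measurable lebesgue"
    "(\<lambda>x. indicat_real {a..b} x *\<^sub>R F x) \<in> borel_measurable lebesgue"
    by (simp_all add: borel_measurable_times borel_measurable_indicator)
  have "(LINT u:{a..b}|lebesgue. g u) = (LINT u:{a..b}|lebesgue. F u)"
    unfolding set_lebesgue_integral_def
  proof (rule integral_cong_AE[OF m])
    show "AE x in lebesgue. indicat_real {a..b} x *\<^sub>R g x = indicat_real {a..b} x *\<^sub>R F x"
      using ae by (intro AE_completion) (auto elim: eventually_mono)
  qed
  also have "\<dots> = (LINT u:{a..b}|lborel. F u)"
    unfolding set_lebesgue_integral_def using F by (intro integral_completion) measurable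
  finally show ?thesis .
qed

section \<open>Convexity and Jensen inequalities\<close>

lemma convex_on_scale:
  fixes \<phi> :: "real \<Rightarrow> real"
  assumes "convex_on {0..} \<phi>" "\<phi> 0 = 0" "0 \<le> s" "s \<le> 1" "0 \<le> u"
  shows "\<phi> (s * u) \<le> s * \<phi> u"
  using convex_onD[OF assms(1), of s 0 u] assms by simp

text \<open>\<open>x + y\<close> is the midpoint of \<open>2 * x\<close> and \<open>2 * y\<close>.
  This replaces a triangle inequality for \<phi>, each use costing a doubling of the
  argument.\<close>

lemma convex_on_half_sum:
  fixes \<phi> :: "real \<Rightarrow> real"
  assumes "convex_on {0..} \<phi>" "0 \<le> x" "0 \<le> y"
  shows "\<phi> (x + y) \<le> \<phi> (2 * x) / 2 + \<phi> (2 * y) / 2"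
  using convex_onD[OF assms(1), of "1/2" "2 * x" "2 * y"] assms by simp

text \<open>The modulus is convex and \<phi> is nondecreasing, so the even extension is convex.
  Jensen's inequality for means is applied to signed integrands.\<close>

lemma convex_on_abs:
  fixes \<phi> :: "real \<Rightarrow> real"
  assumes conv: "convex_on {0..} \<phi>" and mono: "mono_on {0..} \<phi>"
  shows "convex_on UNIV (\<lambda>u. \<phi> \<bar>u\<bar>)"
proof (rule convex_onI)
  fix s x y :: real assume s: "0 < s" "s < 1"
  have "\<bar>(1 - s) *\<^sub>R x + s *\<^sub>R y\<bar> \<le> (1 - s) * \<bar>x\<bar> + s * \<bar>y\<bar>"
    using abs_triangle_ineq[of "(1 - s) * x" "s * y"] s by (simp add: abs_mult)
  then have "\<phi> \<bar>(1 - s) *\<^sub>R x + s *\<^sub>R y\<bar> \<le> \<phi> ((1 - s) * \<bar>x\<bar> + s * \<bar>y\<bar>)"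
    using s by (intro mono_onD[OF mono]) auto
  also have "\<dots> \<le> (1 - s) * \<phi> \<bar>x\<bar> + s * \<phi> \<bar>y\<bar>"
    using convex_onD[OF conv, of s "\<bar>x\<bar>" "\<bar>y\<bar>"] s by simp
  finally show "\<phi> \<bar>(1 - s) *\<^sub>R x + s *\<^sub>R y\<bar> \<le> (1 - s) * \<phi> \<bar>x\<bar> + s * \<phi> \<bar>y\<bar>" .
qed simp

text \<open>Normalising the weights by their sum \<open>S\<close> gives ordinary Jensen; the missing
  mass \<open>1 - S\<close> sits at 0, where \<phi> vanishes.\<close>

lemma convex_on_sum_subprob:
  fixes \<phi> :: "real \<Rightarrow> real" and p z :: "'a \<Rightarrow> real"
  assumes conv: "convex_on {0..} \<phi>" and "\<phi> 0 = 0" and "finite A"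
    and p: "\<And>i. i \<in> A \<Longrightarrow> 0 \<le> p i" and z: "\<And>i. i \<in> A \<Longrightarrow> 0 \<le> z i" and le: "sum p A \<le> 1"
  shows "\<phi> (\<Sum>i\<in>A. p i * z i) \<le> (\<Sum>i\<in>A. p i * \<phi> (z i))"
proof (cases "sum p A = 0")
  case True
  then have "\<forall>i\<in>A. p i = 0" using \<open>finite A\<close> p by (simp add: sum_nonneg_eq_0_iff)
  then show ?thesis using \<open>\<phi> 0 = 0\<close> by simp
next
  case False
  define S where "S = sum p A"
  have S: "0 < S" "S \<le> 1" using False p sum_nonneg[of A p] le by (auto simp: S_def)
  have "\<phi> (\<Sum>i\<in>A. p i * z i) = \<phi> (S * (\<Sum>i\<in>A. (p i / S) *\<^sub>R z i))"
    using S by (simp add: sum_distrib_left)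
  also have "\<dots> \<le> S * \<phi> (\<Sum>i\<in>A. (p i / S) *\<^sub>R z i)"
    using assms S by (intro convex_on_scale) (auto intro!: sum_nonneg mult_nonneg_nonneg divide_nonneg_pos)
  also have "\<dots> \<le> S * (\<Sum>i\<in>A. (p i / S) * \<phi> (z i))"
    using assms S False
    by (intro mult_left_mono convex_on_sum[OF _ _ conv])
      (auto simp flip: sum_divide_distrib simp: S_def)
  also have "\<dots> = (\<Sum>i\<in>A. p i * \<phi> (z i))"
    using S by (simp add: sum_distrib_left)
  finally show ?thesis .
qed

lemma mono_on_nonneg:
  fixes \<phi> :: "real \<Rightarrow> real"
  assumes "mono_on {0..} \<phi>" "\<phi> 0 = 0" "0 \<le> u"
  shows "0 \<le> \<phi> u"
  using mono_onD[OF assms(1), of 0 u] assms by simp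

text \<open>Finite Jensen applies to each partial sum, and continuity of \<phi> carries the bound to
  the limit. Only the signed series of the \<open>d n\<close> has to converge; the right-hand side
  may be infinite.\<close>

lemma jensen_sums:
  fixes \<phi> :: "real \<Rightarrow> real" and p z d :: "nat \<Rightarrow> real"
  assumes conv: "convex_on {0..} \<phi>" and mono: "mono_on {0..} \<phi>" and cont: "continuous_on {0..} \<phi>"
    and z0: "\<phi> 0 = 0"
    and p: "\<And>n. 0 \<le> p n" and z: "\<And>n. 0 \<le> z n" and M: "\<And>N. (\<Sum>n<N. p n) \<le> M" "0 < M"
    and d: "d sums D" "\<And>n. \<bar>d n\<bar> \<le> p n * z n" and c: "0 \<le> c"
  shows "ennreal (\<phi> (c * \<bar>D\<bar>)) \<le> ennreal (1 / M) * (\<Sum>n. ennreal (p n) * ennreal (\<phi> (c * M * z n)))"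
proof -
  have lim: "(\<lambda>N. ennreal (\<phi> (c * \<bar>\<Sum>n<N. d n\<bar>))) \<longlonglongrightarrow> ennreal (\<phi> (c * \<bar>D\<bar>))"
  proof (rule tendsto_ennrealI)
    show "(\<lambda>N. \<phi> (c * \<bar>\<Sum>n<N. d n\<bar>)) \<longlonglongrightarrow> \<phi> (c * \<bar>D\<bar>)"
      by (rule continuous_on_tendsto_compose[OF cont])
        (use d c in \<open>auto simp: sums_def intro!: tendsto_intros always_eventually\<close>)
  qed
  have "ennreal (\<phi> (c * \<bar>\<Sum>n<N. d n\<bar>))
      \<le> ennreal (1 / M) * (\<Sum>n. ennreal (p n) * ennreal (\<phi> (c * M * z n)))" for N
  proof -
    have "\<bar>\<Sum>n<N. d n\<bar> \<le> (\<Sum>n<N. p n * z n)"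
      by (rule order.trans[OF sum_abs sum_mono[OF d(2)]])
    then have "c * \<bar>\<Sum>n<N. d n\<bar> \<le> c * (\<Sum>n<N. p n * z n)"
      using c by (rule mult_left_mono)
    \<comment> \<open>Dividing the weights by \<open>M\<close> makes their sum at most 1; the factor
      \<open>M\<close> moves into the argument of \<phi>.\<close>
    also have "\<dots> = (\<Sum>n<N. (p n / M) * (c * M * z n))"
      using M by (simp add: sum_distrib_left mult_ac)
    finally have "\<phi> (c * \<bar>\<Sum>n<N. d n\<bar>) \<le> \<phi> (\<Sum>n<N. (p n / M) * (c * M * z n))"
      by (intro mono_onD[OF mono]) (use c p z M in \<open>auto intro!: sum_nonneg\<close>)
    also have "\<dots> \<le> (\<Sum>n<N. (p n / M) * \<phi> (c * M * z n))"
      using M p z c by (intro convex_on_sum_subprob[OF conv z0]) (auto simp flip: sum_divide_distrib)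
    also have "\<dots> = 1 / M * (\<Sum>n<N. p n * \<phi> (c * M * z n))"
      by (simp add: sum_distrib_left)
    finally have "ennreal (\<phi> (c * \<bar>\<Sum>n<N. d n\<bar>))
        \<le> ennreal (1 / M * (\<Sum>n<N. p n * \<phi> (c * M * z n)))"
      by (rule ennreal_leI)
    also have "\<dots> = ennreal (1 / M) * (\<Sum>n<N. ennreal (p n) * ennreal (\<phi> (c * M * z n)))"
    proof -
      have nn: "0 \<le> \<phi> (c * M * z n)" for n
        using M z c by (intro mono_on_nonneg[OF mono z0]) auto
      then have "(\<Sum>n<N. ennreal (p n) * ennreal (\<phi> (c * M * z n)))
          = ennreal (\<Sum>n<N. p n * \<phi> (c * M * z n))"
        using p by (subst sum_ennreal[symmetric]) (auto simp: ennreal_mult)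
      moreover have "0 \<le> (\<Sum>n<N. p n * \<phi> (c * M * z n))"
        using p nn by (intro sum_nonneg mult_nonneg_nonneg)
      ultimately show ?thesis
        using M by (subst ennreal_mult) simp_all
    qed
    also have "\<dots> \<le> ennreal (1 / M) * (\<Sum>n. ennreal (p n) * ennreal (\<phi> (c * M * z n)))"
      by (intro mult_left_mono sum_le_suminf) auto
    finally show ?thesis .
  qed
  then show ?thesis
    by (intro tendsto_upperbound[OF lim] always_eventually) auto
qed

text \<open>A supporting line of \<open>h\<close> at the mean \<open>m\<close> lies below
  \<open>h\<close>, and along \<open>g\<close> it integrates over the interval to exactly
  \<open>(b - a) * h m\<close>.\<close>

lemma jensen_interval:
  fixes h g :: "real \<Rightarrow> real"
  assumes conv: "convex_on UNIV h" and h0: "\<And>u. 0 \<le> h u" and [measurable]: "h \<in> borel_measurable borel"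
    and [measurable]: "g \<in> borel_measurable borel"
    and int: "set_integrable lborel {a..b} g" and "a < b"
  shows "ennreal (h (1 / (b - a) * (LINT u:{a..b}|lborel. g u)))
    \<le> ennreal (1 / (b - a)) * (\<integral>\<^sup>+u\<in>{a..b}. ennreal (h (g u)) \<partial>lborel)"
proof (cases "(\<integral>\<^sup>+u\<in>{a..b}. ennreal (h (g u)) \<partial>lborel) = \<infinity>")
  case True
  then show ?thesis using \<open>a < b\<close> by (simp add: ennreal_mult_top)
next
  case False
  define m where "m = 1 / (b - a) * (LINT u:{a..b}|lborel. g u)"
  \<comment> \<open>\<open>s\<close> is the right derivative of \<open>h\<close> at
    \<open>m\<close>, hence the slope of a supporting line.\<close>
  define s where "s = Inf ((\<lambda>t. (h m - h t) / (m - t)) ` ({m<..} \<inter> UNIV))"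
  have line: "h m + s * (y - m) \<le> h y" for y
    unfolding s_def by (rule convex_le_Inf_differential[OF conv]) auto
  have inth: "set_integrable lborel {a..b} (\<lambda>u. h (g u))"
    unfolding set_integrable_def real_scaleR_def
  proof (rule integrableI_nonneg)
    have "(\<integral>\<^sup>+x. ennreal (indicator {a..b} x * h (g x)) \<partial>lborel)
        = (\<integral>\<^sup>+u\<in>{a..b}. ennreal (h (g u)) \<partial>lborel)"
      by (intro nn_integral_cong) (auto split: split_indicator)
    then show "(\<integral>\<^sup>+x. ennreal (indicator {a..b} x * h (g x)) \<partial>lborel) < \<infinity>"
      using False by (simp add: less_top)
  qed (use h0 in auto)
  have c: "set_integrable lborel {a..b} (\<lambda>u. k::real)" for k
    unfolding set_integrable_def using \<open>a < b\<close> by simp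
  have "(b - a) * h m = (LINT u:{a..b}|lborel. h m + s * (g u - m))"
  proof -
    have "(LINT u:{a..b}|lborel. h m + s * (g u - m))
        = (LINT u:{a..b}|lborel. h m - s * m) + s * (LINT u:{a..b}|lborel. g u)"
      by (subst set_integral_mult_right[symmetric], subst set_integral_add(2)[symmetric])
        (use int c in \<open>auto simp: algebra_simps\<close>)
    also have "(LINT u:{a..b}|lborel. h m - s * m) = (b - a) * (h m - s * m)"
      unfolding set_lebesgue_integral_def using \<open>a < b\<close> by simp
    also have "(LINT u:{a..b}|lborel. g u) = (b - a) * m" using \<open>a < b\<close> by (simp add: m_def)
    finally show ?thesis by (simp add: algebra_simps)
  qed
  also have "\<dots> \<le> (LINT u:{a..b}|lborel. h (g u))"
    using line int c inth by (intro set_integral_mono set_integral_add set_integrable_mult_right set_integral_diff) auto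
  also have "\<dots> = enn2real (\<integral>\<^sup>+u\<in>{a..b}. ennreal (h (g u)) \<partial>lborel)"
    unfolding set_lebesgue_integral_def using h0
    by (subst integral_eq_nn_integral) (auto intro!: arg_cong[where f=enn2real] nn_integral_cong split: split_indicator)
  finally have "h m \<le> 1 / (b - a) * enn2real (\<integral>\<^sup>+u\<in>{a..b}. ennreal (h (g u)) \<partial>lborel)"
    using \<open>a < b\<close> by (simp add: field_simps)
  then have "ennreal (h m) \<le> ennreal (1 / (b - a) * enn2real (\<integral>\<^sup>+u\<in>{a..b}. ennreal (h (g u)) \<partial>lborel))"
    by (rule ennreal_leI)
  also have "\<dots> = ennreal (1 / (b - a)) * (\<integral>\<^sup>+u\<in>{a..b}. ennreal (h (g u)) \<partial>lborel)"
    using False \<open>a < b\<close> by (subst ennreal_mult) (auto simp: ennreal_enn2real_if)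
  finally show ?thesis by (simp add: m_def)
qed

section \<open>Kernel sums over a sequence with unit steps\<close>

lemma unit_step_sequence:
  fixes t :: "int \<Rightarrow> real"
  assumes "\<And>k. t (k + 1) - t k = 1"
  shows "t k = t 0 + of_int k"
proof (induction k rule: int_induct[where k=0])
  case (step1 i) then show ?case using assms[of i] by simp
next
  case (step2 i) then show ?case using assms[of "i - 1"] by simp
qed simp

text \<open>The \<open>\<beta>\<close>-moment controls the terms with \<open>\<bar>ln x - t k\<bar> \<ge> 1\<close>, and at most three of the others
  occur, each bounded by \<open>sup L\<close>.\<close>

lemma kernel_sum_bound:
  fixes t :: "int \<Rightarrow> real" and L :: "real \<Rightarrow> real"
  assumes t: "\<And>k. t (k + 1) - t k = 1" and L0: "\<And>x. 0 < x \<Longrightarrow> 0 \<le> L x"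
    and bd: "bounded (L ` {0<..})" and mom: "discrete_moment t \<beta> L < \<infinity>" and "0 < \<beta>"
  obtains M where "1 \<le> M"
    "\<And>x A. 0 < x \<Longrightarrow> finite A \<Longrightarrow> (\<Sum>k\<in>A. L (exp (- t k) * x)) \<le> M"
proof -
  obtain B where B: "\<And>x. 0 < x \<Longrightarrow> L x \<le> B"
    using bd unfolding bounded_iff by (metis abs_le_D1 greaterThan_iff image_eqI real_norm_def)
  have "0 \<le> B" using B[of 1] L0[of 1] by simp
  obtain m where m: "discrete_moment t \<beta> L = ennreal m" "0 \<le> m"
    using mom by (cases "discrete_moment t \<beta> L") auto
  have "(\<Sum>k\<in>A. L (exp (- t k) * x)) \<le> 1 + m + 3 * B" if x: "0 < x" and A: "finite A" for x A
  proof -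
    define y where "y = ln x - t 0"
    define N where "N = {k. \<bar>ln x - t k\<bar> < 1}"
    have N: "N \<subseteq> {\<lfloor>y\<rfloor> - 1..\<lfloor>y\<rfloor> + 1}"
    proof
      fix k assume "k \<in> N"
      then have "\<bar>y - of_int k\<bar> < 1"
        unfolding N_def y_def using unit_step_sequence[of t k, OF t] by (simp add: algebra_simps)
      then show "k \<in> {\<lfloor>y\<rfloor> - 1..\<lfloor>y\<rfloor> + 1}" by simp linarith
    qed
    have fN: "finite N" using N finite_subset by blast
    have "card N \<le> 3" using card_mono[OF _ N] by simp
    let ?g = "\<lambda>k. L (exp (- t k) * x) * \<bar>ln x - t k\<bar> powr \<beta>"
    have L0': "0 \<le> L (exp (- t k) * x)" for k using L0 x by simp
    have "(\<Sum>k\<in>A. L (exp (- t k) * x)) \<le> (\<Sum>k\<in>A. ?g k + (if k \<in> N then B else 0))"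
    proof (rule sum_mono)
      fix k
      show "L (exp (- t k) * x) \<le> ?g k + (if k \<in> N then B else 0)"
      proof (cases "k \<in> N")
        case True
        then show ?thesis using B[of "exp (- t k) * x"] x L0'[of k] by (simp add: add_increasing)
      next
        case False
        then have "1 \<le> \<bar>ln x - t k\<bar> powr \<beta>"
          using \<open>0 < \<beta>\<close> by (intro ge_one_powr_ge_zero) (auto simp: N_def)
        then show ?thesis using False mult_left_mono[OF _ L0'[of k]] by fastforce
      qed
    qed
    also have "\<dots> = (\<Sum>k\<in>A. ?g k) + of_nat (card (A \<inter> N)) * B"
      using A by (simp add: sum.distrib sum.If_cases)
    also have "\<dots> \<le> m + 3 * B"
    proof (intro add_mono mult_right_mono)
      have "ennreal (\<Sum>k\<in>A. ?g k) = (\<Sum>k\<in>A. ennreal (?g k))"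
        using L0' by (subst sum_ennreal) auto
      also have "\<dots> \<le> (\<Sum>\<^sub>\<infinity>k. ennreal (?g k))"
        using A by (subst infsum_finite[symmetric], assumption, intro infsum_mono_neutral)
          (auto intro: nonneg_summable_on_complete)
      also have "\<dots> \<le> discrete_moment t \<beta> L"
        unfolding discrete_moment_def using x by (intro SUP_upper) auto
      finally show "(\<Sum>k\<in>A. ?g k) \<le> m" using m by simp
      have "card (A \<inter> N) \<le> 3" using card_mono[OF fN, of "A \<inter> N"] \<open>card N \<le> 3\<close> by simp
      then show "real (card (A \<inter> N)) \<le> 3" by simp
    qed (use \<open>0 \<le> B\<close> in auto)
    finally show ?thesis by simp
  qed
  moreover have "1 \<le> 1 + m + 3 * B" using m \<open>0 \<le> B\<close> by simp
  ultimately show ?thesis using that by blast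
qed

section \<open>Double integrals of Kantorovich type\<close>

text \<open>Half-open cells of length \<open>1 / w\<close> partition the line, and closing them adds
  only null sets. \<open>int_decode\<close> lists the integer-indexed cells as a sequence, so that
  integrals and \<open>suminf\<close> can be exchanged.\<close>

lemma nn_integral_unit_partition:
  fixes g :: "real \<Rightarrow> ennreal" and s :: "nat \<Rightarrow> real"
  assumes [measurable]: "g \<in> borel_measurable borel" and "0 < w"
    and s: "\<And>n. s n = c + of_int (int_decode n)"
  shows "(\<Sum>n. \<integral>\<^sup>+u\<in>{s n / w..(s n + 1) / w}. g u \<partial>lborel) = (\<integral>\<^sup>+u. g u \<partial>lborel)"
proof -
  have "(\<integral>\<^sup>+u\<in>{s n / w..(s n + 1) / w}. g u \<partial>lborel)
      = (\<integral>\<^sup>+u. g u * indicator {s n / w..<(s n + 1) / w} u \<partial>lborel)" for n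
    using AE_lborel_singleton[of "(s n + 1) / w"]
    by (intro nn_integral_cong_AE) (auto elim!: eventually_mono split: split_indicator)
  then have "(\<Sum>n. \<integral>\<^sup>+u\<in>{s n / w..(s n + 1) / w}. g u \<partial>lborel)
      = (\<integral>\<^sup>+u. (\<Sum>n. g u * indicator {s n / w..<(s n + 1) / w} u) \<partial>lborel)"
    by (subst nn_integral_suminf) auto
  also have "\<dots> = (\<integral>\<^sup>+u. g u \<partial>lborel)"
  proof (rule nn_integral_cong)
    fix u
    \<comment> \<open>The unique cell containing \<open>u\<close> has the integer index
      \<open>\<lfloor>w * u - c\<rfloor>\<close>.\<close>
    define k where "k = int_encode \<lfloor>w * u - c\<rfloor>"
    have "indicator {s n / w..<(s n + 1) / w} u = (if n = k then 1 else 0 :: ennreal)" for n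
    proof -
      have "u \<in> {s n / w..<(s n + 1) / w} \<longleftrightarrow> \<lfloor>w * u - c\<rfloor> = int_decode n"
        using \<open>0 < w\<close> unfolding floor_eq_iff s by (auto simp: field_simps)
      also have "\<dots> \<longleftrightarrow> n = k" unfolding k_def by (metis int_decode_inverse int_encode_inverse)
      finally show ?thesis by (simp add: indicator_def)
    qed
    then have "(\<Sum>n. g u * indicator {s n / w..<(s n + 1) / w} u) = (\<Sum>n. if n = k then g u else 0)"
      by (intro suminf_cong) simp
    also have "\<dots> = g u" using sums_single[of k "\<lambda>_. g u"] by (simp add: sums_iff)
    finally show "(\<Sum>n. g u * indicator {s n / w..<(s n + 1) / w} u) = g u" .
  qed
  finally show ?thesis .
qed

lemma nn_integral_translate:
  fixes g :: "real \<Rightarrow> ennreal"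
  assumes "g \<in> borel_measurable borel"
  shows "(\<integral>\<^sup>+v. g (v + c) \<partial>lborel) = (\<integral>\<^sup>+v. g v \<partial>lborel)"
  using nn_integral_real_affine[OF assms, of 1 c] by (simp add: add.commute)

text \<open>With \<open>r = u - s n / w\<close> the difference \<open>F u - F v\<close> is split at the point \<open>v + r\<close>.  The first
  part depends on \<open>u\<close> and the shift \<open>v - s n / w\<close> only, so the sum over the intervals reassembles the
  integral over the line; the second is a shift by at most \<open>1 / w\<close>, independent of \<open>n\<close>.\<close>

lemma kantorovich_double_integral_le:
  fixes h h' \<Lambda> :: "real \<Rightarrow> ennreal" and F :: "real \<Rightarrow> real" and s :: "nat \<Rightarrow> real"
  assumes [measurable]: "h \<in> borel_measurable borel" "h' \<in> borel_measurable borel"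
      "\<Lambda> \<in> borel_measurable borel" "F \<in> borel_measurable borel"
    and w: "0 < w" and s: "\<And>n. s n = c + of_int (int_decode n)"
    and split: "\<And>x y z. h (x - z) \<le> h' (x - y) + h' (y - z)"
    and M: "AE v in lborel. (\<Sum>n. \<Lambda> (w * v - s n)) \<le> M"
  shows "(\<integral>\<^sup>+v. (\<Sum>n. \<Lambda> (w * v - s n) *
            (ennreal w * (\<integral>\<^sup>+u\<in>{s n / w..(s n + 1) / w}. h (F u - F v) \<partial>lborel))) \<partial>lborel)
    \<le> (\<integral>\<^sup>+z. ennreal w * \<Lambda> (w * z) * (\<integral>\<^sup>+u. h' (F u - F (u + z)) \<partial>lborel) \<partial>lborel)
      + M * (ennreal w * (\<integral>\<^sup>+r\<in>{0..1 / w}. (\<integral>\<^sup>+v. h' (F (v + r) - F v) \<partial>lborel) \<partial>lborel))"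
    (is "?L \<le> ?A + ?B")
proof -
  \<comment> \<open>With \<open>r = u - s n / w\<close>, \<open>A n\<close> carries the difference
    of \<open>F\<close> at \<open>u\<close> and \<open>v + r\<close>, while \<open>Q\<close> carries
    the difference at \<open>v + r\<close> and \<open>v\<close>, from which \<open>n\<close> has
    disappeared.\<close>
  define A where "A n v = ennreal w * \<Lambda> (w * v - s n) *
      (\<integral>\<^sup>+u\<in>{s n / w..(s n + 1) / w}. h' (F u - F (v + u - s n / w)) \<partial>lborel)" for n v
  define Q where "Q v = (\<integral>\<^sup>+r\<in>{0..1 / w}. h' (F (v + r) - F v) \<partial>lborel)" for v
  have [measurable]: "A n \<in> borel_measurable borel" for n
    unfolding A_def by measurable
  have [measurable]: "Q \<in> borel_measurable borel"
    unfolding Q_def by measurable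
  have step: "\<Lambda> (w * v - s n) * (ennreal w * (\<integral>\<^sup>+u\<in>{s n / w..(s n + 1) / w}. h (F u - F v) \<partial>lborel))
      \<le> A n v + \<Lambda> (w * v - s n) * (ennreal w * Q v)" for n v
  proof -
    have "(\<integral>\<^sup>+u\<in>{s n / w..(s n + 1) / w}. h (F u - F v) \<partial>lborel)
        \<le> (\<integral>\<^sup>+u. h' (F u - F (v + u - s n / w)) * indicator {s n / w..(s n + 1) / w} u
            + h' (F (v + u - s n / w) - F v) * indicator {s n / w..(s n + 1) / w} u \<partial>lborel)"
      using split by (intro nn_integral_mono) (auto split: split_indicator)
    also have "\<dots> = (\<integral>\<^sup>+u\<in>{s n / w..(s n + 1) / w}. h' (F u - F (v + u - s n / w)) \<partial>lborel)
        + (\<integral>\<^sup>+u\<in>{s n / w..(s n + 1) / w}. h' (F (v + u - s n / w) - F v) \<partial>lborel)"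
      by (rule nn_integral_add) measurable
    \<comment> \<open>Substituting \<open>u = r + s n / w\<close> maps the cell onto the interval
      from 0 to \<open>1 / w\<close>.\<close>
    also have "(\<integral>\<^sup>+u\<in>{s n / w..(s n + 1) / w}. h' (F (v + u - s n / w) - F v) \<partial>lborel)
        = (\<integral>\<^sup>+r. h' (F (v + (r + s n / w) - s n / w) - F v)
            * indicator {s n / w..(s n + 1) / w} (r + s n / w) \<partial>lborel)"
      by (rule nn_integral_translate[symmetric]) measurable
    also have "\<dots> = Q v"
      unfolding Q_def using w
      by (intro nn_integral_cong) (auto simp: add_divide_distrib split: split_indicator)
    finally have "\<Lambda> (w * v - s n) * (ennreal w * (\<integral>\<^sup>+u\<in>{s n / w..(s n + 1) / w}. h (F u - F v) \<partial>lborel))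
      \<le> \<Lambda> (w * v - s n) * (ennreal w *
        ((\<integral>\<^sup>+u\<in>{s n / w..(s n + 1) / w}. h' (F u - F (v + u - s n / w)) \<partial>lborel) + Q v))"
      by (intro mult_left_mono) auto
    then show ?thesis by (simp add: A_def distrib_left mult_ac)
  qed
  have "?L \<le> (\<integral>\<^sup>+v. (\<Sum>n. A n v) + (\<Sum>n. \<Lambda> (w * v - s n)) * (ennreal w * Q v) \<partial>lborel)"
  proof (intro nn_integral_mono)
    fix v
    have "(\<Sum>n. \<Lambda> (w * v - s n) * (ennreal w * (\<integral>\<^sup>+u\<in>{s n / w..(s n + 1) / w}. h (F u - F v) \<partial>lborel)))
      \<le> (\<Sum>n. A n v + \<Lambda> (w * v - s n) * (ennreal w * Q v))"
      by (intro suminf_le step) auto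
    also have "\<dots> = (\<Sum>n. A n v) + (\<Sum>n. \<Lambda> (w * v - s n)) * (ennreal w * Q v)"
      by (subst suminf_add[symmetric]) auto
    finally show "(\<Sum>n. \<Lambda> (w * v - s n) * (ennreal w * (\<integral>\<^sup>+u\<in>{s n / w..(s n + 1) / w}. h (F u - F v) \<partial>lborel)))
      \<le> (\<Sum>n. A n v) + (\<Sum>n. \<Lambda> (w * v - s n)) * (ennreal w * Q v)" .
  qed
  also have "\<dots> = (\<integral>\<^sup>+v. (\<Sum>n. A n v) \<partial>lborel) + (\<integral>\<^sup>+v. (\<Sum>n. \<Lambda> (w * v - s n)) * (ennreal w * Q v) \<partial>lborel)"
    by (rule nn_integral_add) measurable
  also have "(\<integral>\<^sup>+v. (\<Sum>n. A n v) \<partial>lborel) = ?A"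
  proof -
    \<comment> \<open>Under \<open>v = z + s n / w\<close> the weight becomes
      \<open>\<Lambda> (w * z)\<close>. The index \<open>n\<close> survives only in the cell of
      \<open>u\<close>, so summation restores the integral over the line.\<close>
    have "(\<integral>\<^sup>+v. A n v \<partial>lborel) = (\<integral>\<^sup>+z. ennreal w * \<Lambda> (w * z) *
        (\<integral>\<^sup>+u\<in>{s n / w..(s n + 1) / w}. h' (F u - F (u + z)) \<partial>lborel) \<partial>lborel)" for n
    proof -
      have "(\<integral>\<^sup>+v. A n v \<partial>lborel) = (\<integral>\<^sup>+z. A n (z + s n / w) \<partial>lborel)"
        by (rule nn_integral_translate[symmetric]) measurable
      also have "\<dots> = (\<integral>\<^sup>+z. ennreal w * \<Lambda> (w * z) *
        (\<integral>\<^sup>+u\<in>{s n / w..(s n + 1) / w}. h' (F u - F (u + z)) \<partial>lborel) \<partial>lborel)"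
        unfolding A_def using w by (intro nn_integral_cong) (simp add: algebra_simps)
      finally show ?thesis .
    qed
    then have "(\<integral>\<^sup>+v. (\<Sum>n. A n v) \<partial>lborel) = (\<Sum>n. \<integral>\<^sup>+z. ennreal w * \<Lambda> (w * z) *
        (\<integral>\<^sup>+u\<in>{s n / w..(s n + 1) / w}. h' (F u - F (u + z)) \<partial>lborel) \<partial>lborel)"
      by (subst nn_integral_suminf) auto
    also have "\<dots> = (\<integral>\<^sup>+z. (\<Sum>n. ennreal w * \<Lambda> (w * z) *
        (\<integral>\<^sup>+u\<in>{s n / w..(s n + 1) / w}. h' (F u - F (u + z)) \<partial>lborel)) \<partial>lborel)"
      by (rule nn_integral_suminf[symmetric]) measurable
    also have "\<dots> = ?A"
    proof (rule nn_integral_cong)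
      fix z
      show "(\<Sum>n. ennreal w * \<Lambda> (w * z) *
          (\<integral>\<^sup>+u\<in>{s n / w..(s n + 1) / w}. h' (F u - F (u + z)) \<partial>lborel))
        = ennreal w * \<Lambda> (w * z) * (\<integral>\<^sup>+u. h' (F u - F (u + z)) \<partial>lborel)"
        by (subst ennreal_suminf_cmult) (simp add: nn_integral_unit_partition[OF _ w s])
    qed
    finally show ?thesis .
  qed
  \<comment> \<open>As \<open>Q v\<close> is independent of \<open>n\<close>, the weights can be
    summed, giving at most \<open>M\<close> for almost every \<open>v\<close>.\<close>
  also have "(\<integral>\<^sup>+v. (\<Sum>n. \<Lambda> (w * v - s n)) * (ennreal w * Q v) \<partial>lborel)
      \<le> (\<integral>\<^sup>+v. M * (ennreal w * Q v) \<partial>lborel)"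
    using M by (intro nn_integral_mono_AE) (auto elim!: eventually_mono intro!: mult_right_mono)
  also have "\<dots> = M * (ennreal w * (\<integral>\<^sup>+v. Q v \<partial>lborel))"
    by (simp add: nn_integral_cmult)
  also have "(\<integral>\<^sup>+v. Q v \<partial>lborel)
      = (\<integral>\<^sup>+r\<in>{0..1 / w}. (\<integral>\<^sup>+v. h' (F (v + r) - F v) \<partial>lborel) \<partial>lborel)"
    unfolding Q_def by (subst lborel_pair.Fubini') (simp_all add: nn_integral_multc)
  finally show ?thesis by (simp add: add_left_mono)
qed

section \<open>Modulars in additive coordinates\<close>

lemma AE_log_measure_shift:
  assumes ae: "AE v in lborel. F v = f (exp v)"
  shows "AE x in log_measure. F (ln x + z) = f (x * exp z)"
proof -
  have "AE v in lborel. F (v + z) = f (exp (v + z))"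
    using AE_lborel_affine[OF ae, of 1 z] by (simp add: add.commute)
  from AE_log_measure_ln[OF this] AE_log_measure_pos show ?thesis
    by eventually_elim (simp add: exp_add)
qed

text \<open>\<open>B\<close> carries the measurability, so the bound applies to the error of the
  operator without establishing measurability of the kernel series.\<close>

lemma modular_le_nn_integral:
  assumes [measurable]: "B \<in> borel_measurable borel"
    and "AE v in lborel. ennreal (\<phi> \<bar>g (exp v)\<bar>) \<le> B v"
  shows "modular \<phi> g \<le> (\<integral>\<^sup>+v. B v \<partial>lborel)"
proof -
  have "AE x in log_measure. ennreal (\<phi> \<bar>g x\<bar>) \<le> B (ln x)"
    using AE_log_measure_ln[OF assms(2)] AE_log_measure_pos by eventually_elim simp
  then have "modular \<phi> g \<le> (\<integral>\<^sup>+x. B (ln x) \<partial>log_measure)"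
    unfolding modular_def by (rule nn_integral_mono_AE)
  also have "\<dots> = (\<integral>\<^sup>+v. B v \<partial>lborel)"
    by (rule nn_integral_log_measure_ln) measurable
  finally show ?thesis .
qed

lemma borel_measurable_abs_comp:
  fixes \<phi> :: "real \<Rightarrow> real"
  assumes "continuous_on {0..} \<phi>"
  shows "(\<lambda>x. \<phi> \<bar>x\<bar>) \<in> borel_measurable borel"
  by (intro borel_measurable_continuous_onI continuous_on_compose2[OF assms] continuous_intros) auto

lemma modular_eq_nn_integral:
  fixes \<phi> F f :: "real \<Rightarrow> real"
  assumes cont: "continuous_on {0..} \<phi>" and [measurable]: "F \<in> borel_measurable borel"
    and ae: "AE v in lborel. F v = f (exp v)"
  shows "modular \<phi> (\<lambda>x. a * f x) = (\<integral>\<^sup>+v. ennreal (\<phi> \<bar>a * F v\<bar>) \<partial>lborel)"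
proof -
  note [measurable] = borel_measurable_abs_comp[OF cont]
  have "AE x in log_measure. ennreal (\<phi> \<bar>a * f x\<bar>) = ennreal (\<phi> \<bar>a * F (ln x)\<bar>)"
    using AE_log_measure_shift[OF ae, of 0] by eventually_elim simp
  then have "modular \<phi> (\<lambda>x. a * f x) = (\<integral>\<^sup>+x. ennreal (\<phi> \<bar>a * F (ln x)\<bar>) \<partial>log_measure)"
    unfolding modular_def by (rule nn_integral_cong_AE)
  also have "\<dots> = (\<integral>\<^sup>+v. ennreal (\<phi> \<bar>a * F v\<bar>) \<partial>lborel)"
    by (rule nn_integral_log_measure_ln) (use measurable_compose[of "\<lambda>v. a * F v" _ _ "\<lambda>x. \<phi> \<bar>x\<bar>"] in measurable)
  finally show ?thesis .
qed

text \<open>Translation by \<open>z\<close> in \<open>v\<close> is dilation by \<open>exp z\<close>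
  in \<open>x\<close>. The room between \<open>b\<close> and \<open>a\<close> lets the scale
  supplied by the log-Hoelder class differ from the one produced by convexity.\<close>

lemma shift_integral_le_log_modulus:
  fixes \<eta> F f :: "real \<Rightarrow> real"
  assumes cont: "continuous_on {0..} \<eta>" and mono: "mono_on {0..} \<eta>"
    and F[measurable]: "F \<in> borel_measurable borel" and ae: "AE v in lborel. F v = f (exp v)"
    and ab: "0 \<le> b" "b \<le> a" and z: "\<bar>z\<bar> \<le> \<delta>"
  shows "(\<integral>\<^sup>+v. ennreal (\<eta> (b * \<bar>F (v + z) - F v\<bar>)) \<partial>lborel) \<le> log_modulus \<eta> (\<lambda>x. a * f x) \<delta>"
proof -
  note m = borel_measurable_abs_comp[OF cont]
  have "(\<lambda>v. \<eta> \<bar>a * (F (v + z) - F v)\<bar>) \<in> borel_measurable borel"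
    by (rule measurable_compose[OF _ m]) measurable
  then have m': "(\<lambda>v. \<eta> (a * \<bar>F (v + z) - F v\<bar>)) \<in> borel_measurable borel"
    using ab by (simp add: abs_mult)
  have "(\<integral>\<^sup>+v. ennreal (\<eta> (b * \<bar>F (v + z) - F v\<bar>)) \<partial>lborel)
      \<le> (\<integral>\<^sup>+v. ennreal (\<eta> (a * \<bar>F (v + z) - F v\<bar>)) \<partial>lborel)"
    using ab by (intro nn_integral_mono ennreal_leI mono_onD[OF mono]) (auto intro: mult_right_mono)
  also have "\<dots> = (\<integral>\<^sup>+x. ennreal (\<eta> (a * \<bar>F (ln x + z) - F (ln x)\<bar>)) \<partial>log_measure)"
    by (rule nn_integral_log_measure_ln[symmetric]) (use m' in measurable)
  also have "\<dots> = modular \<eta> (\<lambda>s. a * f (s * exp z) - a * f s)"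
    unfolding modular_def
  proof (rule nn_integral_cong_AE)
    have scale: "a * \<bar>p - q\<bar> = \<bar>a * p - a * q\<bar>" for p q
      using ab by (simp add: abs_mult flip: right_diff_distrib)
    show "AE x in log_measure. ennreal (\<eta> (a * \<bar>F (ln x + z) - F (ln x)\<bar>))
        = ennreal (\<eta> \<bar>a * f (x * exp z) - a * f x\<bar>)"
      using AE_log_measure_shift[OF ae, of z] AE_log_measure_shift[OF ae, of 0]
      by eventually_elim (simp add: scale)
  qed
  also have "\<dots> \<le> log_modulus \<eta> (\<lambda>x. a * f x) \<delta>"
    unfolding log_modulus_def using z by (intro SUP_upper) simp
  finally show ?thesis .
qed

text \<open>For positive \<open>y\<close>, \<open>y powr w = exp (w * ln y)\<close>. Taking
  \<open>S\<close> as the whole line yields the total mass of the kernel, taking the outside of an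
  interval its tail.\<close>

lemma nn_integral_kernel_dilation:
  fixes L \<Lambda> :: "real \<Rightarrow> real"
  assumes [measurable]: "\<Lambda> \<in> borel_measurable borel" "S \<in> sets borel"
    and ae: "AE v in lborel. \<Lambda> v = L (exp v)" and "0 < w"
  shows "(\<integral>\<^sup>+y\<in>{y. ln y \<in> S}. ennreal (L (y powr w)) \<partial>log_measure)
    = (\<integral>\<^sup>+z\<in>S. ennreal (\<Lambda> (w * z)) \<partial>lborel)"
proof -
  have "AE z in lborel. \<Lambda> (w * z) = L (exp (w * z))"
    using AE_lborel_affine[OF ae, of w 0] \<open>0 < w\<close> by simp
  from AE_log_measure_ln[OF this] AE_log_measure_pos
  have "(\<integral>\<^sup>+y\<in>{y. ln y \<in> S}. ennreal (L (y powr w)) \<partial>log_measure)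
      = (\<integral>\<^sup>+y. ennreal (\<Lambda> (w * ln y)) * indicator S (ln y) \<partial>log_measure)"
    by (intro nn_integral_cong_AE, eventually_elim) (simp add: powr_def split: split_indicator)
  also have "\<dots> = (\<integral>\<^sup>+z\<in>S. ennreal (\<Lambda> (w * z)) \<partial>lborel)"
    by (rule nn_integral_log_measure_ln) measurable
  finally show ?thesis .
qed

section \<open>Local integrability from a finite modular\<close>

text \<open>For \<open>u > 1\<close> the point 1 lies between 0 and \<open>u\<close>, so convexity
  forces at least linear growth, with slope \<open>\<eta> 1\<close>.\<close>

lemma le_one_plus_convex:
  fixes \<eta> :: "real \<Rightarrow> real"
  assumes "convex_on {0..} \<eta>" "mono_on {0..} \<eta>" "\<eta> 0 = 0" "0 < \<eta> 1" "0 \<le> u"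
  shows "u \<le> 1 + \<eta> u / \<eta> 1"
proof (cases "u \<le> 1")
  case True
  then show ?thesis using mono_on_nonneg[OF assms(2,3,5)] assms(4) by (simp add: add_increasing2)
next
  case False
  then have "\<eta> (1 / u * u) \<le> 1 / u * \<eta> u"
    using assms by (intro convex_on_scale) auto
  then have "u * \<eta> 1 \<le> \<eta> u" using False by (simp add: field_simps)
  then have "u \<le> \<eta> u / \<eta> 1" using assms(4) by (simp add: field_simps)
  then show ?thesis by simp
qed

text \<open>Linear growth turns the modular into an integrable majorant on bounded intervals. The
  bound sees the length of the interval but not its position, so means over cells are bounded
  uniformly.\<close>

lemma modular_imp_set_integrable:
  fixes \<eta> F :: "real \<Rightarrow> real"
  assumes conv: "convex_on {0..} \<eta>" and mono: "mono_on {0..} \<eta>" and cont: "continuous_on {0..} \<eta>"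
    and \<eta>: "\<eta> 0 = 0" "0 < \<eta> 1"
    and F[measurable]: "F \<in> borel_measurable borel" and "0 < a"
    and fin: "(\<integral>\<^sup>+v. ennreal (\<eta> \<bar>a * F v\<bar>) \<partial>lborel) < \<infinity>"
  shows "set_integrable lborel {p..q} F"
    and "p \<le> q \<Longrightarrow> \<bar>LINT u:{p..q}|lborel. F u\<bar>
      \<le> ((q - p) + (LINT v|lborel. \<eta> \<bar>a * F v\<bar>) / \<eta> 1) / a"
proof -
  define G where "G v = \<eta> \<bar>a * F v\<bar>" for v
  have [measurable]: "G \<in> borel_measurable borel"
    unfolding G_def by (rule measurable_compose[OF _ borel_measurable_abs_comp[OF cont]]) measurable
  have G0: "0 \<le> G v" for v unfolding G_def by (rule mono_on_nonneg[OF mono \<eta>(1)]) simp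
  have intG: "integrable lborel G"
    using fin G0 by (intro integrableI_nonneg) (auto simp: G_def)
  have le: "\<bar>F v\<bar> \<le> 1 / a + G v / (a * \<eta> 1)" for v
  proof -
    have "\<bar>a * F v\<bar> \<le> 1 + G v / \<eta> 1"
      unfolding G_def by (rule le_one_plus_convex[OF conv mono \<eta>]) simp
    then have "a * \<bar>F v\<bar> \<le> 1 + G v / \<eta> 1" using \<open>0 < a\<close> by (simp add: abs_mult)
    then show ?thesis using \<open>0 < a\<close> \<eta> by (simp add: field_simps)
  qed
  have int1: "integrable lborel (\<lambda>v. indicator {p..q} v * (1 / a) + G v / (a * \<eta> 1))"
    using intG by (intro Bochner_Integration.integrable_add integrable_mult_left integrable_divide
      integrable_real_indicator) (auto simp: emeasure_lborel_Icc_eq)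
  have intF: "integrable lborel (\<lambda>v. indicator {p..q} v * F v)"
  proof (rule Bochner_Integration.integrable_bound[OF int1])
    show "AE v in lborel. norm (indicator {p..q} v * F v)
        \<le> norm (indicator {p..q} v * (1 / a) + G v / (a * \<eta> 1))"
      using le G0 \<open>0 < a\<close> \<eta> by (auto split: split_indicator intro: order.trans[OF le abs_ge_self])
  qed measurable
  then show "set_integrable lborel {p..q} F" by (simp add: set_integrable_def)
  assume "p \<le> q"
  have "\<bar>LINT u:{p..q}|lborel. F u\<bar> \<le> (LINT v|lborel. \<bar>indicator {p..q} v * F v\<bar>)"
    unfolding set_lebesgue_integral_def real_scaleR_def by (rule integral_abs_bound)
  also have "\<dots> \<le> (LINT v|lborel. indicator {p..q} v * (1 / a) + G v / (a * \<eta> 1))"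
    using intF int1 by (intro integral_mono) (use le G0 \<open>0 < a\<close> \<eta> in \<open>auto split: split_indicator\<close>)
  also have "\<dots> = (q - p) * (1 / a) + (LINT v|lborel. G v) / (a * \<eta> 1)"
    using intG \<open>p \<le> q\<close> by (subst Bochner_Integration.integral_add) auto
  also have "\<dots> = ((q - p) + (LINT v|lborel. \<eta> \<bar>a * F v\<bar>) / \<eta> 1) / a"
    using \<open>0 < a\<close> \<eta> by (simp add: field_simps G_def)
  finally show "\<bar>LINT u:{p..q}|lborel. F u\<bar>
      \<le> ((q - p) + (LINT v|lborel. \<eta> \<bar>a * F v\<bar>) / \<eta> 1) / a" .
qed

section \<open>Convergence rate\<close>

text \<open>The series with the constant \<open>y\<close> in place of the values \<open>m k\<close>
  is inserted: the defect controls its distance from \<open>y\<close>, and \<open>D\<close> is the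
  remaining difference series. The bound \<open>R\<close> provides the summable majorant
  \<open>L\<close> times \<open>\<psi> R\<close>; enumeration by naturals prepares for
  \<open>jensen_sums\<close>.\<close>

lemma kernel_series_error:
  assumes ker: "starred_kernel t L \<psi> \<alpha> \<beta> \<kappa>"
    and M: "\<And>x A. 0 < x \<Longrightarrow> finite A \<Longrightarrow> (\<Sum>k\<in>A. L (exp (- t k) * x)) \<le> M"
    and x: "0 < x" and w: "0 < w" and m: "\<And>k. \<bar>m k\<bar> \<le> R"
    and def: "kernel_defect t \<kappa> w x \<le> ennreal \<delta>" "0 \<le> \<delta>"
  obtains D where
    "(\<lambda>n. \<kappa> (exp (- t (int_decode n)) * x powr w) (m (int_decode n))
        - \<kappa> (exp (- t (int_decode n)) * x powr w) y) sums D"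
    "\<bar>(\<Sum>\<^sub>\<infinity>k. \<kappa> (exp (- t k) * x powr w) (m k)) - y\<bar> \<le> \<bar>D\<bar> + \<delta> * \<bar>y\<bar>"
proof -
  let ?X = "\<lambda>k. exp (- t k) * x powr w"
  have X: "0 < ?X k" for k using x by simp
  have L0: "0 \<le> L z" if "0 < z" for z using ker that unfolding starred_kernel_def by blast
  have lip: "\<bar>\<kappa> z u - \<kappa> z v\<bar> \<le> L z * \<psi> \<bar>u - v\<bar>" if "0 < z" for z u v
    using ker that unfolding starred_kernel_def by blast
  have k0: "\<kappa> z 0 = 0" if "0 < z" for z using ker that unfolding starred_kernel_def by blast
  have mono: "mono_on {0..} \<psi>" using ker unfolding starred_kernel_def by blast
  have "(\<lambda>k. L (?X k)) summable_on UNIV"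
  proof (rule nonneg_bdd_above_summable_on)
    show "bdd_above (sum (\<lambda>k. L (?X k)) ` {F. F \<subseteq> UNIV \<and> finite F})"
      using M[of "x powr w"] x by (intro bdd_aboveI[of _ M]) auto
  qed (use L0 X in auto)
  then have sL: "(\<lambda>k. L (?X k) * \<psi> R) summable_on UNIV" by (rule summable_on_cmult_left)
  have "(\<lambda>k. \<kappa> (?X k) (m k)) summable_on UNIV"
  proof (rule Infinite_Sum.abs_summable_summable, rule Infinite_Sum.abs_summable_on_comparison_test')
    show "(\<lambda>k. L (?X k) * \<psi> R) summable_on UNIV" by (rule sL)
    fix k
    have "\<bar>\<kappa> (?X k) (m k)\<bar> \<le> L (?X k) * \<psi> \<bar>m k\<bar>"
      using lip[OF X, of k "m k" 0] k0[OF X] by simp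
    also have "\<dots> \<le> L (?X k) * \<psi> R"
      using m[of k] L0[OF X] by (intro mult_left_mono mono_onD[OF mono]) auto
    finally show "norm (\<kappa> (?X k) (m k)) \<le> L (?X k) * \<psi> R" by simp
  qed
  then have hm: "((\<lambda>k. \<kappa> (?X k) (m k)) has_sum (\<Sum>\<^sub>\<infinity>k. \<kappa> (?X k) (m k))) UNIV" (is "(_ has_sum ?Sm) _")
    by (rule has_sum_infsum)
  have "\<forall>x>0. \<forall>u. \<forall>w>0. (\<lambda>k. \<bar>\<kappa> (exp (- t k) * x powr w) u\<bar>) summable_on UNIV"
    using ker by (simp add: starred_kernel_def)
  then have "(\<lambda>k. \<bar>\<kappa> (?X k) y\<bar>) summable_on UNIV"
    using x w by simp
  then have "(\<lambda>k. \<kappa> (?X k) y) summable_on UNIV"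
    unfolding real_norm_def[symmetric] by (rule Infinite_Sum.abs_summable_summable)
  then have hy: "((\<lambda>k. \<kappa> (?X k) y) has_sum (\<Sum>\<^sub>\<infinity>k. \<kappa> (?X k) y)) UNIV" (is "(_ has_sum ?Sy) _")
    by (rule has_sum_infsum)
  have "((\<lambda>n. \<kappa> (?X (int_decode n)) (m (int_decode n)) - \<kappa> (?X (int_decode n)) y) has_sum (?Sm - ?Sy)) UNIV"
    using has_sum_add[OF hm has_sum_uminusI[OF hy]] has_sum_reindex_bij_betw[OF bij_int_decode, of "\<lambda>k. \<kappa> (?X k) (m k) - \<kappa> (?X k) y"]
    by simp
  then have "(\<lambda>n. \<kappa> (?X (int_decode n)) (m (int_decode n)) - \<kappa> (?X (int_decode n)) y) sums (?Sm - ?Sy)"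
    by (rule has_sum_imp_sums)
  moreover have "\<bar>?Sy - y\<bar> \<le> \<delta> * \<bar>y\<bar>"
  \<comment> \<open>The defect is a supremum over nonzero values only; at 0 the kernel
    vanishes.\<close>
  proof (cases "y = 0")
    case True
    then show ?thesis using k0[OF X] by simp
  next
    case False
    then have "ennreal \<bar>1 / y * ?Sy - 1\<bar> \<le> kernel_defect t \<kappa> w x"
      unfolding kernel_defect_def by (intro SUP_upper) simp
    with def have "\<bar>1 / y * ?Sy - 1\<bar> \<le> \<delta>" by (metis ennreal_le_iff order_trans)
    then have "\<bar>1 / y * ?Sy - 1\<bar> * \<bar>y\<bar> \<le> \<delta> * \<bar>y\<bar>" by (rule mult_right_mono) simp
    moreover have "\<bar>1 / y * ?Sy - 1\<bar> * \<bar>y\<bar> = \<bar>?Sy - y\<bar>"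
      using False by (simp add: field_simps flip: abs_mult)
    ultimately show ?thesis by simp
  qed
  ultimately show ?thesis by (intro that[of "?Sm - ?Sy"]) linarith+
qed

text \<open>The four summands come from the kernel defect, the shifts
  \<open>\<bar>z\<bar> \<le> \<delta>\<close>, the larger shifts, and the shifts inside a cell. The
  constants record the doublings: \<open>2 * l\<close> arises from splitting at
  \<open>v + r\<close>, \<open>4 * l\<close> from separating the two values of \<open>F\<close> in a
  large shift, and \<open>2 * c\<close> from separating the difference series from the defect. The
  factor \<open>M\<close> beside \<open>2 * c\<close> is the one from Jensen for sums.\<close>

lemma exp_kantorovich_modular_le:
  fixes t :: "int \<Rightarrow> real" and \<kappa> :: "real \<Rightarrow> real \<Rightarrow> real"
    and L \<psi> \<phi> \<eta> f :: "real \<Rightarrow> real"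
  assumes t: "\<And>k. t (k + 1) - t k = 1"
    and ker: "starred_kernel t L \<psi> \<alpha> \<beta> \<kappa>"
    and \<phi>: "phi_function \<phi>" "convex_on {0..} \<phi>"
    and \<eta>: "phi_function \<eta>" "convex_on {0..} \<eta>"
    and f: "f \<in> borel_measurable log_measure"
    and a: "0 < a" "modular \<eta> (\<lambda>x. a * f x) < \<infinity>"
    and l: "0 < l" "4 * l \<le> a" "2 * l \<le> b"
    and C: "0 < C" "\<And>u. 0 \<le> u \<Longrightarrow> \<phi> (C * \<psi> u) \<le> \<eta> (l * u)"
    and M: "1 \<le> M" "\<And>x A. 0 < x \<Longrightarrow> finite A \<Longrightarrow> (\<Sum>k\<in>A. L (exp (- t k) * x)) \<le> M"
    and K: "0 < K" "\<And>x. 0 < x \<Longrightarrow> kernel_defect t \<kappa> w x \<le> ennreal (K * w powr (- \<alpha>))"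
    and c: "0 < c" "2 * c * M \<le> C" "2 * c * K \<le> a"
    and w: "1 \<le> w"
  shows "modular \<phi> (\<lambda>x. c * (exp_kantorovich t \<kappa> w f x - f x))
    \<le> ennreal (w powr (- \<alpha>)) * modular \<phi> (\<lambda>x. a * f x)
      + (\<integral>\<^sup>+y. ennreal (L y) \<partial>log_measure) * log_modulus \<eta> (\<lambda>x. b * f x) \<delta>
      + 2 * modular \<eta> (\<lambda>x. a * f x) *
        (ennreal w * (\<integral>\<^sup>+y\<in>{y. \<delta> < \<bar>ln y\<bar>}. ennreal (L (y powr w)) \<partial>log_measure))
      + ennreal M * log_modulus \<eta> (\<lambda>x. b * f x) (1 / w)"
proof -
  have \<phi>': "mono_on {0..} \<phi>" "continuous_on {0..} \<phi>" "\<phi> 0 = 0"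
    and \<eta>': "mono_on {0..} \<eta>" "continuous_on {0..} \<eta>" "\<eta> 0 = 0" "0 < \<eta> 1"
    using \<phi> \<eta> by (auto simp: phi_function_def)
  have L0: "0 \<le> L z" if "0 < z" for z using ker that unfolding starred_kernel_def by blast
  have lip: "\<bar>\<kappa> z u - \<kappa> z v\<bar> \<le> L z * \<psi> \<bar>u - v\<bar>" if "0 < z" for z u v
    using ker that unfolding starred_kernel_def by blast
  have Lm: "L \<in> borel_measurable log_measure" and \<psi>: "mono_on {0..} \<psi>" "\<psi> 0 = 0" and "0 < \<alpha>"
    using ker unfolding starred_kernel_def by blast+
  have \<psi>0: "0 \<le> \<psi> u" if "0 \<le> u" for u using mono_on_nonneg[OF \<psi> that] .
  obtain F where F[measurable]: "F \<in> borel_measurable borel" and F_ae: "AE v in lborel. F v = f (exp v)"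
    using borel_representative_exp[OF f] .
  obtain \<Lambda> where \<Lambda>[measurable]: "\<Lambda> \<in> borel_measurable borel" and \<Lambda>_ae: "AE v in lborel. \<Lambda> v = L (exp v)"
    using borel_representative_exp[OF Lm] .
  define s where "s n = t (int_decode n)" for n
  have s: "s n = t 0 + of_int (int_decode n)" for n
    unfolding s_def by (rule unit_step_sequence[of t, OF t])
  have w0: "0 < w" using w by simp
  define h where "h r = ennreal (\<eta> (l * \<bar>r\<bar>))" for r
  define h' where "h' r = ennreal (\<eta> (2 * l * \<bar>r\<bar>))" for r
  note \<phi>m = borel_measurable_abs_comp[OF \<phi>'(2)] and \<eta>m = borel_measurable_abs_comp[OF \<eta>'(2)]
  have \<eta>l: "(\<lambda>r. \<eta> (d * \<bar>r\<bar>)) \<in> borel_measurable borel" if "0 \<le> d" for d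
    using measurable_compose[of "\<lambda>r. d * r" borel borel, OF _ \<eta>m] that by (simp add: abs_mult)
  have \<phi>a: "(\<lambda>v. \<phi> \<bar>a * F v\<bar>) \<in> borel_measurable borel"
    by (rule measurable_compose[OF _ \<phi>m]) measurable
  have \<eta>a: "(\<lambda>u. ennreal (\<eta> \<bar>a * F (u + z)\<bar>)) \<in> borel_measurable borel" for z
    by (rule measurable_compose[OF measurable_compose[OF _ \<eta>m] measurable_ennreal]) measurable
  have [measurable]: "h \<in> borel_measurable borel" "h' \<in> borel_measurable borel"
    unfolding h_def h'_def using \<eta>l[of l, OF less_imp_le[OF l(1)]] \<eta>l[of "2 * l"] l(1)
    by simp_all
  define T where "T v = (\<Sum>n. ennreal (\<Lambda> (w * v - s n)) *
      (ennreal w * (\<integral>\<^sup>+u\<in>{s n / w..(s n + 1) / w}. h (F u - F v) \<partial>lborel)))" for v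
  have Tm[measurable]: "T \<in> borel_measurable borel" unfolding T_def by measurable
  define I where "I = (\<integral>\<^sup>+v. ennreal (\<eta> \<bar>a * F v\<bar>) \<partial>lborel)"
  have I: "modular \<eta> (\<lambda>x. a * f x) = I"
    unfolding I_def by (rule modular_eq_nn_integral[OF \<eta>'(2) F F_ae])
  have fin: "(\<integral>\<^sup>+v. ennreal (\<eta> \<bar>a * F v\<bar>) \<partial>lborel) < \<infinity>"
    using a I by (simp add: I_def)
  note Fint = modular_imp_set_integrable[OF \<eta>(2) \<eta>'(1,2,3,4) F a(1) fin]

  define m where "m k = w / (t (k + 1) - t k) * (LINT u:{t k / w..t (k + 1) / w}|lebesgue. f (exp u))" for k
  have K_eq: "exp_kantorovich t \<kappa> w f x = (\<Sum>\<^sub>\<infinity>k. \<kappa> (exp (- t k) * x powr w) (m k))" for x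
    unfolding exp_kantorovich_def m_def ..
  have m_eq: "m k = w * (LINT u:{t k / w..(t k + 1) / w}|lborel. F u)" for k
  proof -
    have "t (k + 1) = t k + 1" using t[of k] by simp
    then show ?thesis unfolding m_def using set_integral_lebesgue_AE_eq[OF F F_ae] by simp
  qed
  define R where "R = w * ((1 / w + (LINT v|lborel. \<eta> \<bar>a * F v\<bar>) / \<eta> 1) / a)"
  have mR: "\<bar>m k\<bar> \<le> R" for k
  proof -
    have "(t k + 1) / w - t k / w = 1 / w" by (simp add: diff_divide_distrib[symmetric])
    then have "\<bar>LINT u:{t k / w..(t k + 1) / w}|lborel. F u\<bar>
        \<le> (1 / w + (LINT v|lborel. \<eta> \<bar>a * F v\<bar>) / \<eta> 1) / a"
      using Fint(2)[of "t k / w" "(t k + 1) / w"] w0 by (simp add: divide_right_mono)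
    then have "w * \<bar>LINT u:{t k / w..(t k + 1) / w}|lborel. F u\<bar> \<le> R"
      unfolding R_def using w0 by (intro mult_left_mono) auto
    then show ?thesis unfolding m_eq using w0 by (simp add: abs_mult)
  qed
  \<comment> \<open>Jensen over a cell of length \<open>1 / w\<close>, for the even extension of
    \<eta> and the integrand \<open>l * F u - l * y\<close>.\<close>
  have jensen: "ennreal (\<eta> (l * \<bar>m (int_decode n) - y\<bar>))
      \<le> ennreal w * (\<integral>\<^sup>+u\<in>{s n / w..(s n + 1) / w}. h (F u - y) \<partial>lborel)" for n y
  proof -
    let ?a = "s n / w" and ?b = "(s n + 1) / w"
    have len: "?b - ?a = 1 / w" by (simp add: diff_divide_distrib[symmetric])
    have ab: "?a < ?b" using w0 by (simp add: divide_strict_right_mono)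
    have cy: "set_integrable lborel {?a..?b} (\<lambda>u. l * y)"
      unfolding set_integrable_def using ab by simp
    have int: "set_integrable lborel {?a..?b} (\<lambda>u. l * F u - l * y)"
      using cy Fint(1) by (intro set_integral_diff) auto
    have "1 / (?b - ?a) * (LINT u:{?a..?b}|lborel. l * F u - l * y)
        = w * (l * (LINT u:{?a..?b}|lborel. F u) - (?b - ?a) * (l * y))"
    proof -
      have "(LINT u:{?a..?b}|lborel. l * y) = (?b - ?a) * (l * y)"
        unfolding set_lebesgue_integral_def using ab by simp
      then show ?thesis using cy Fint(1) len by (subst set_integral_diff(2)) auto
    qed
    also have "\<dots> = l * (m (int_decode n) - y)"
      unfolding len m_eq s_def using w0 by (simp add: field_simps)
    finally have "ennreal (\<eta> \<bar>l * (m (int_decode n) - y)\<bar>)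
      \<le> ennreal (1 / (?b - ?a)) * (\<integral>\<^sup>+u\<in>{?a..?b}. ennreal (\<eta> \<bar>l * F u - l * y\<bar>) \<partial>lborel)"
      using jensen_interval[OF convex_on_abs[OF \<eta>(2) \<eta>'(1)] mono_on_nonneg[OF \<eta>'(1,3)] \<eta>m _ int ab]
      by simp
    also have "(\<lambda>u. \<bar>l * F u - l * y\<bar>) = (\<lambda>u. l * \<bar>F u - y\<bar>)"
      using l by (simp add: abs_mult flip: right_diff_distrib)
    finally show ?thesis using l by (simp add: h_def len abs_mult)
  qed
  \<comment> \<open>Countably many null sets are united, so that one \<open>v\<close> serves the
    whole series.\<close>
  have \<Lambda>s: "AE v in lborel. \<forall>n. \<Lambda> (w * v - s n) = L (exp (- s n) * exp v powr w)"
  proof (subst AE_all_countable, intro allI)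
    fix n
    have "exp (- s n + w * v) = exp (- s n) * exp v powr w" for v
      by (simp only: exp_add) (simp add: powr_def)
    with AE_lborel_affine[OF \<Lambda>_ae, of w "- s n"] w0
    show "AE v in lborel. \<Lambda> (w * v - s n) = L (exp (- s n) * exp v powr w)"
      by simp
  qed
  have partial: "(\<Sum>n<N. L (exp (- s n) * x)) \<le> M" if "0 < x" for N x
  proof -
    have "(\<Sum>n<N. L (exp (- s n) * x)) = (\<Sum>k\<in>int_decode ` {..<N}. L (exp (- t k) * x))"
      unfolding s_def by (subst sum.reindex) (auto intro: inj_on_subset[OF inj_int_decode])
    then show ?thesis using M(2)[OF that, of "int_decode ` {..<N}"] by simp
  qed
  have pointwise: "AE v in lborel. ennreal (\<phi> \<bar>c * (exp_kantorovich t \<kappa> w f (exp v) - f (exp v))\<bar>)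
      \<le> ennreal (w powr (- \<alpha>)) * ennreal (\<phi> \<bar>a * F v\<bar>) + T v"
    using \<Lambda>s F_ae
  proof eventually_elim
    case (elim v)
    let ?X = "\<lambda>n. exp (- s n) * exp v powr w"
    have X: "0 < ?X n" for n by simp
    obtain D where D: "(\<lambda>n. \<kappa> (?X n) (m (int_decode n)) - \<kappa> (?X n) (F v)) sums D"
      "\<bar>exp_kantorovich t \<kappa> w f (exp v) - F v\<bar> \<le> \<bar>D\<bar> + K * w powr (- \<alpha>) * \<bar>F v\<bar>"
    proof (rule kernel_series_error[OF ker M(2), where x="exp v" and w=w and m=m and R=R
          and \<delta>="K * w powr (- \<alpha>)" and y="F v", folded K_eq s_def])
      show "kernel_defect t \<kappa> w (exp v) \<le> ennreal (K * w powr (- \<alpha>))" by (rule K(2)) simp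
      show "0 \<le> K * w powr (- \<alpha>)" using K(1) by simp
    qed (use w0 mR in auto)
    have "\<bar>c * (exp_kantorovich t \<kappa> w f (exp v) - F v)\<bar> \<le> c * \<bar>D\<bar> + c * K * w powr (- \<alpha>) * \<bar>F v\<bar>"
      using mult_left_mono[OF D(2), of c] c by (simp add: abs_mult distrib_left mult.assoc)
    then have "\<phi> \<bar>c * (exp_kantorovich t \<kappa> w f (exp v) - F v)\<bar>
        \<le> \<phi> (c * \<bar>D\<bar> + c * K * w powr (- \<alpha>) * \<bar>F v\<bar>)"
      using c K by (intro mono_onD[OF \<phi>'(1)]) auto
    also have "\<dots> \<le> \<phi> (2 * (c * \<bar>D\<bar>)) / 2 + \<phi> (2 * (c * K * w powr (- \<alpha>) * \<bar>F v\<bar>)) / 2"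
      using c K by (intro convex_on_half_sum[OF \<phi>(2)]) auto
    \<comment> \<open>Both halves are dropped. In the defect term convexity extracts
      \<open>w powr (- \<alpha>)\<close>, which is at most 1 because
      \<open>1 \<le> w\<close>.\<close>
    also have "\<dots> \<le> \<phi> (2 * c * \<bar>D\<bar>) + w powr (- \<alpha>) * \<phi> \<bar>a * F v\<bar>"
    proof -
      have "\<phi> (2 * (c * K * w powr (- \<alpha>) * \<bar>F v\<bar>)) = \<phi> (w powr (- \<alpha>) * (2 * c * K * \<bar>F v\<bar>))"
        by (simp add: mult_ac)
      also have "\<dots> \<le> w powr (- \<alpha>) * \<phi> (2 * c * K * \<bar>F v\<bar>)"
        using powr_mono[of "- \<alpha>" 0 w] w \<open>0 < \<alpha>\<close> c K
        by (intro convex_on_scale[OF \<phi>(2) \<phi>'(3)]) auto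
      also have "\<dots> \<le> w powr (- \<alpha>) * \<phi> \<bar>a * F v\<bar>"
        using c K a by (intro mult_left_mono mono_onD[OF \<phi>'(1)]) (auto simp: abs_mult intro!: mult_right_mono)
      finally have "\<phi> (2 * (c * K * w powr (- \<alpha>) * \<bar>F v\<bar>)) \<le> w powr (- \<alpha>) * \<phi> \<bar>a * F v\<bar>" .
      moreover have "0 \<le> \<phi> (2 * (c * K * w powr (- \<alpha>) * \<bar>F v\<bar>))" "0 \<le> \<phi> (2 * (c * \<bar>D\<bar>))"
        using c K by (auto intro!: mono_on_nonneg[OF \<phi>'(1,3)])
      ultimately show ?thesis by (simp add: mult.assoc)
    qed
    finally have "ennreal (\<phi> \<bar>c * (exp_kantorovich t \<kappa> w f (exp v) - F v)\<bar>)
        \<le> ennreal (\<phi> (2 * c * \<bar>D\<bar>) + w powr (- \<alpha>) * \<phi> \<bar>a * F v\<bar>)"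
      by (rule ennreal_leI)
    also have "\<dots> = ennreal (\<phi> (2 * c * \<bar>D\<bar>)) + ennreal (w powr (- \<alpha>)) * ennreal (\<phi> \<bar>a * F v\<bar>)"
      using c by (subst ennreal_plus) (auto intro!: ennreal_mult mult_nonneg_nonneg mono_on_nonneg[OF \<phi>'(1,3)])
    also have "ennreal (\<phi> (2 * c * \<bar>D\<bar>)) \<le> T v"
    proof -
      have "ennreal (\<phi> (2 * c * \<bar>D\<bar>)) \<le> ennreal (1 / M) *
          (\<Sum>n. ennreal (L (?X n)) * ennreal (\<phi> (2 * c * M * \<psi> \<bar>m (int_decode n) - F v\<bar>)))"
      proof (rule jensen_sums[OF \<phi>(2) \<phi>' _ _ _ _ D(1)])
        show "0 \<le> L (?X n)" for n by (rule L0[OF X])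
        show "0 \<le> \<psi> \<bar>m (int_decode n) - F v\<bar>" for n by (rule \<psi>0) simp
        show "(\<Sum>n<N. L (?X n)) \<le> M" for N by (rule partial) simp
        show "\<bar>\<kappa> (?X n) (m (int_decode n)) - \<kappa> (?X n) (F v)\<bar>
            \<le> L (?X n) * \<psi> \<bar>m (int_decode n) - F v\<bar>" for n by (rule lip[OF X])
      qed (use c M(1) in auto)
      \<comment> \<open>\<open>1 \<le> M\<close> removes \<open>1 / M\<close>. Termwise,
        \<open>2 * c * M \<le> C\<close> brings in the comparison of \<phi> with \<eta>, followed by
        Jensen on the cell.\<close>
      also have "\<dots> \<le> 1 * T v"
        unfolding T_def
      proof (rule mult_mono, goal_cases)
        case 2
        show ?case
        proof (rule suminf_le)
          fix n
          have "\<phi> (2 * c * M * \<psi> \<bar>m (int_decode n) - F v\<bar>) \<le> \<phi> (C * \<psi> \<bar>m (int_decode n) - F v\<bar>)"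
            using c M(1) C \<psi>0 by (intro mono_onD[OF \<phi>'(1)] mult_right_mono) auto
          also have "\<dots> \<le> \<eta> (l * \<bar>m (int_decode n) - F v\<bar>)" by (rule C) simp
          finally have "ennreal (\<phi> (2 * c * M * \<psi> \<bar>m (int_decode n) - F v\<bar>))
              \<le> ennreal (\<eta> (l * \<bar>m (int_decode n) - F v\<bar>))" by (rule ennreal_leI)
          also note jensen
          finally show "ennreal (L (?X n)) * ennreal (\<phi> (2 * c * M * \<psi> \<bar>m (int_decode n) - F v\<bar>))
              \<le> ennreal (\<Lambda> (w * v - s n)) *
                (ennreal w * (\<integral>\<^sup>+u\<in>{s n / w..(s n + 1) / w}. h (F u - F v) \<partial>lborel))"
            using elim(1) by (simp add: mult_left_mono)
        qed auto
      qed (use M(1) in \<open>auto simp: ennreal_le_1\<close>)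
      finally show ?thesis by simp
    qed
    finally have "ennreal (\<phi> \<bar>c * (exp_kantorovich t \<kappa> w f (exp v) - F v)\<bar>)
        \<le> T v + ennreal (w powr (- \<alpha>)) * ennreal (\<phi> \<bar>a * F v\<bar>)"
      by (simp add: add_right_mono)
    then show ?case by (simp add: elim(2) add.commute)
  qed
  have \<Lambda>M: "AE v in lborel. (\<Sum>n. ennreal (\<Lambda> (w * v - s n))) \<le> ennreal M"
    using \<Lambda>s
  proof eventually_elim
    case (elim v)
    have "(\<Sum>n<N. ennreal (\<Lambda> (w * v - s n))) \<le> ennreal M" for N
    proof -
      have "(\<Sum>n<N. ennreal (\<Lambda> (w * v - s n))) = ennreal (\<Sum>n<N. L (exp (- s n) * exp v powr w))"
        using elim L0 by (subst sum_ennreal[symmetric]) auto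
      also have "\<dots> \<le> ennreal M" using partial by (intro ennreal_leI) simp
      finally show ?thesis .
    qed
    then show ?case by (intro suminf_le_const) auto
  qed
  have shift: "(\<integral>\<^sup>+v. h' (F (v + z) - F v) \<partial>lborel) \<le> log_modulus \<eta> (\<lambda>x. b * f x) d"
    if "\<bar>z\<bar> \<le> d" for z d
    unfolding h'_def using l that by (intro shift_integral_le_log_modulus[OF \<eta>'(2,1) F F_ae]) auto
  have h'_sym: "h' (F u - F (u + z)) = h' (F (u + z) - F u)" for u z
    by (simp add: h'_def abs_minus_commute)
  \<comment> \<open>The bound is uniform in \<open>z\<close>, because every translate of
    \<open>F\<close> has the same modular \<open>I\<close>.\<close>
  have far: "(\<integral>\<^sup>+u. h' (F u - F (u + z)) \<partial>lborel) \<le> 2 * I" for z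
  proof -
    have "(\<integral>\<^sup>+u. h' (F u - F (u + z)) \<partial>lborel)
        \<le> (\<integral>\<^sup>+u. ennreal (\<eta> \<bar>a * F u\<bar>) + ennreal (\<eta> \<bar>a * F (u + z)\<bar>) \<partial>lborel)"
    proof (rule nn_integral_mono)
      fix u
      have "\<eta> (2 * l * \<bar>F u - F (u + z)\<bar>) \<le> \<eta> (2 * l * \<bar>F u\<bar> + 2 * l * \<bar>F (u + z)\<bar>)"
        using l mult_left_mono[OF abs_triangle_ineq4[of "F u" "F (u + z)"], of "2 * l"]
        by (intro mono_onD[OF \<eta>'(1)]) (auto simp: distrib_left)
      also have "\<dots> \<le> \<eta> (2 * (2 * l * \<bar>F u\<bar>)) / 2 + \<eta> (2 * (2 * l * \<bar>F (u + z)\<bar>)) / 2"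
        using l by (intro convex_on_half_sum[OF \<eta>(2)]) auto
      also have "\<dots> \<le> \<eta> \<bar>a * F u\<bar> + \<eta> \<bar>a * F (u + z)\<bar>"
      proof -
        have *: "\<eta> (2 * (2 * l * \<bar>r\<bar>)) / 2 \<le> \<eta> \<bar>a * r\<bar>" for r
        proof -
          have "\<eta> (2 * (2 * l * \<bar>r\<bar>)) \<le> \<eta> \<bar>a * r\<bar>"
            using l a mult_right_mono[OF l(2), of "\<bar>r\<bar>"]
            by (intro mono_onD[OF \<eta>'(1)]) (auto simp: abs_mult)
          moreover have "0 \<le> \<eta> \<bar>a * r\<bar>" by (rule mono_on_nonneg[OF \<eta>'(1,3)]) simp
          ultimately show ?thesis by linarith
        qed
        show ?thesis by (intro add_mono *)
      qed
      finally show "h' (F u - F (u + z)) \<le> ennreal (\<eta> \<bar>a * F u\<bar>) + ennreal (\<eta> \<bar>a * F (u + z)\<bar>)"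
        unfolding h'_def by (subst ennreal_plus[symmetric])
          (auto intro!: mono_on_nonneg[OF \<eta>'(1,3)] ennreal_leI)
    qed
    also have "\<dots> = I + (\<integral>\<^sup>+u. ennreal (\<eta> \<bar>a * F (u + z)\<bar>) \<partial>lborel)"
      unfolding I_def using \<eta>a[of z] \<eta>a[of 0] by (intro nn_integral_add) simp_all
    also have "(\<integral>\<^sup>+u. ennreal (\<eta> \<bar>a * F (u + z)\<bar>) \<partial>lborel) = I"
      unfolding I_def using \<eta>a[of 0]
      by (intro nn_integral_translate[of "\<lambda>u. ennreal (\<eta> \<bar>a * F u\<bar>)"]) simp
    finally show ?thesis by (simp add: mult_2)
  qed
  have "modular \<phi> (\<lambda>x. c * (exp_kantorovich t \<kappa> w f x - f x))
      \<le> (\<integral>\<^sup>+v. ennreal (w powr (- \<alpha>)) * ennreal (\<phi> \<bar>a * F v\<bar>) + T v \<partial>lborel)"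
    using pointwise by (intro modular_le_nn_integral) (use \<phi>a in measurable)
  also have "\<dots> = ennreal (w powr (- \<alpha>)) * modular \<phi> (\<lambda>x. a * f x) + (\<integral>\<^sup>+v. T v \<partial>lborel)"
    using \<phi>a by (simp add: nn_integral_add nn_integral_cmult modular_eq_nn_integral[OF \<phi>'(2) F F_ae])
  also have "(\<integral>\<^sup>+v. T v \<partial>lborel)
      \<le> (\<integral>\<^sup>+z. ennreal w * ennreal (\<Lambda> (w * z)) * (\<integral>\<^sup>+u. h' (F u - F (u + z)) \<partial>lborel) \<partial>lborel)
      + ennreal M * (ennreal w * (\<integral>\<^sup>+r\<in>{0..1 / w}. (\<integral>\<^sup>+v. h' (F (v + r) - F v) \<partial>lborel) \<partial>lborel))"
    unfolding T_def
  proof (rule kantorovich_double_integral_le[OF _ _ _ F w0 s _ \<Lambda>M])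
    fix x y z :: real
    have "\<eta> (l * \<bar>x - z\<bar>) \<le> \<eta> (l * \<bar>x - y\<bar> + l * \<bar>y - z\<bar>)"
      using l mult_left_mono[of "\<bar>x - z\<bar>" "\<bar>x - y\<bar> + \<bar>y - z\<bar>" l]
      by (intro mono_onD[OF \<eta>'(1)]) (auto simp: distrib_left)
    also have "\<dots> \<le> \<eta> (2 * (l * \<bar>x - y\<bar>)) / 2 + \<eta> (2 * (l * \<bar>y - z\<bar>)) / 2"
      using l by (intro convex_on_half_sum[OF \<eta>(2)]) auto
    also have "\<dots> \<le> \<eta> (2 * l * \<bar>x - y\<bar>) + \<eta> (2 * l * \<bar>y - z\<bar>)"
      using mono_on_nonneg[OF \<eta>'(1,3), of "2 * l * \<bar>x - y\<bar>"] mono_on_nonneg[OF \<eta>'(1,3), of "2 * l * \<bar>y - z\<bar>"] l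
      by (simp add: mult.assoc)
    finally show "h (x - z) \<le> h' (x - y) + h' (y - z)"
      unfolding h_def h'_def using l by (subst ennreal_plus[symmetric])
        (auto intro!: mono_on_nonneg[OF \<eta>'(1,3)] ennreal_leI)
  qed measurable
  also have "(\<integral>\<^sup>+z. ennreal w * ennreal (\<Lambda> (w * z)) * (\<integral>\<^sup>+u. h' (F u - F (u + z)) \<partial>lborel) \<partial>lborel)
      \<le> (\<integral>\<^sup>+y. ennreal (L y) \<partial>log_measure) * log_modulus \<eta> (\<lambda>x. b * f x) \<delta>
      + 2 * I * (ennreal w * (\<integral>\<^sup>+y\<in>{y. \<delta> < \<bar>ln y\<bar>}. ennreal (L (y powr w)) \<partial>log_measure))"
  proof -
    let ?W = "log_modulus \<eta> (\<lambda>x. b * f x) \<delta>"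
    let ?g = "\<lambda>z. ennreal w * ennreal (\<Lambda> (w * z))"
    \<comment> \<open>The modulus is charged at every \<open>z\<close>, not only for small shifts,
      so that the full mass of the kernel appears as its factor.\<close>
    have "(\<integral>\<^sup>+z. ?g z * (\<integral>\<^sup>+u. h' (F u - F (u + z)) \<partial>lborel) \<partial>lborel)
        \<le> (\<integral>\<^sup>+z. ?g z * ?W + 2 * I * (ennreal w * (ennreal (\<Lambda> (w * z)) * indicator {z. \<delta> < \<bar>z\<bar>} z)) \<partial>lborel)"
    proof (rule nn_integral_mono)
      fix z
      show "?g z * (\<integral>\<^sup>+u. h' (F u - F (u + z)) \<partial>lborel)
          \<le> ?g z * ?W + 2 * I * (ennreal w * (ennreal (\<Lambda> (w * z)) * indicator {z. \<delta> < \<bar>z\<bar>} z))"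
      proof (cases "\<bar>z\<bar> \<le> \<delta>")
        case True
        then show ?thesis using mult_left_mono[OF shift[OF True], of "?g z"] by (simp add: h'_sym)
      next
        case False
        have "?g z * (\<integral>\<^sup>+u. h' (F u - F (u + z)) \<partial>lborel) \<le> ?g z * (2 * I)"
          by (intro mult_left_mono far) simp
        then show ?thesis using False by (simp add: mult_ac add_increasing)
      qed
    qed
    also have "\<dots> = (\<integral>\<^sup>+z. ?g z \<partial>lborel) * ?W
        + 2 * I * (ennreal w * (\<integral>\<^sup>+z\<in>{z. \<delta> < \<bar>z\<bar>}. ennreal (\<Lambda> (w * z)) \<partial>lborel))"
      by (simp add: nn_integral_add nn_integral_cmult nn_integral_multc)
    \<comment> \<open>The dilation from \<open>z\<close> to \<open>w * z\<close> absorbs the factor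
      \<open>w\<close>.\<close>
    also have "(\<integral>\<^sup>+z. ?g z \<partial>lborel) = (\<integral>\<^sup>+y. ennreal (L y) \<partial>log_measure)"
    proof -
      have "(\<integral>\<^sup>+z. ?g z \<partial>lborel) = (\<integral>\<^sup>+z. ennreal (\<Lambda> z) \<partial>lborel)"
        using nn_integral_real_affine[of "\<lambda>z. ennreal (\<Lambda> z)" w 0] w0 by (simp add: nn_integral_cmult)
      also have "\<dots> = (\<integral>\<^sup>+y. ennreal (L (y powr 1)) \<partial>log_measure)"
        using nn_integral_kernel_dilation[OF \<Lambda> _ \<Lambda>_ae, of UNIV 1] by simp
      also have "\<dots> = (\<integral>\<^sup>+y. ennreal (L y) \<partial>log_measure)"
        using AE_log_measure_pos by (intro nn_integral_cong_AE) (auto elim!: eventually_mono)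
      finally show ?thesis .
    qed
    also have "(\<integral>\<^sup>+z\<in>{z. \<delta> < \<bar>z\<bar>}. ennreal (\<Lambda> (w * z)) \<partial>lborel)
        = (\<integral>\<^sup>+y\<in>{y. \<delta> < \<bar>ln y\<bar>}. ennreal (L (y powr w)) \<partial>log_measure)"
      using nn_integral_kernel_dilation[OF \<Lambda> _ \<Lambda>_ae w0, of "{z. \<delta> < \<bar>z\<bar>}"] by simp
    finally show ?thesis .
  qed
  \<comment> \<open>The factor \<open>w\<close> cancels the length \<open>1 / w\<close> of the range
    of \<open>r\<close>.\<close>
  also have "ennreal w * (\<integral>\<^sup>+r\<in>{0..1 / w}. (\<integral>\<^sup>+v. h' (F (v + r) - F v) \<partial>lborel) \<partial>lborel)
      \<le> log_modulus \<eta> (\<lambda>x. b * f x) (1 / w)"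
  proof -
    have "(\<integral>\<^sup>+r\<in>{0..1 / w}. (\<integral>\<^sup>+v. h' (F (v + r) - F v) \<partial>lborel) \<partial>lborel)
        \<le> (\<integral>\<^sup>+r\<in>{0..1 / w}. log_modulus \<eta> (\<lambda>x. b * f x) (1 / w) \<partial>lborel)"
      by (intro nn_integral_mono) (auto intro!: shift split: split_indicator)
    also have "\<dots> = log_modulus \<eta> (\<lambda>x. b * f x) (1 / w) * ennreal (1 / w)"
      using w0 by (simp add: nn_integral_cmult)
    finally have "ennreal w * (\<integral>\<^sup>+r\<in>{0..1 / w}. (\<integral>\<^sup>+v. h' (F (v + r) - F v) \<partial>lborel) \<partial>lborel)
        \<le> ennreal w * (log_modulus \<eta> (\<lambda>x. b * f x) (1 / w) * ennreal (1 / w))"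
      by (rule mult_left_mono) simp
    also have "\<dots> = ennreal w * ennreal (1 / w) * log_modulus \<eta> (\<lambda>x. b * f x) (1 / w)"
      by (simp only: mult_ac)
    also have "ennreal w * ennreal (1 / w) = 1"
      using w0 by (simp flip: ennreal_mult)
    finally show ?thesis by simp
  qed
  finally show ?thesis
    unfolding I by (simp add: add.assoc add_left_mono add_right_mono mult_left_mono)
qed

section \<open>Choice of the constants and the resulting rate\<close>

theorem corollary15:
  fixes t :: "int \<Rightarrow> real" and \<kappa> :: "real \<Rightarrow> real \<Rightarrow> real"
    and L \<psi> \<phi> \<eta> f :: "real \<Rightarrow> real" and \<alpha> \<beta> \<gamma> \<gamma>\<^sub>0 \<nu> :: real
  assumes "strict_mono t" and "\<And>k. t (k + 1) - t k = 1"
    and "starred_kernel t L \<psi> \<alpha> \<beta> \<kappa>"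
    and "phi_function \<phi>" and "convex_on {0..} \<phi>"
    and "phi_function \<eta>" and "convex_on {0..} \<eta>"
    and "\<And>a. a \<in> {0<..<1} \<Longrightarrow> \<exists>C\<in>{0<..<1}. \<forall>u\<ge>0. \<phi> (C * \<psi> u) \<le> \<eta> (a * u)"
    and "\<And>g. g \<in> {0<..<1} \<Longrightarrow> \<exists>g\<^sub>0. kernel_tail_decay L g g\<^sub>0"
    and "\<gamma> \<in> {0<..<1}" and "kernel_tail_decay L \<gamma> \<gamma>\<^sub>0"
    and "0 < \<nu>" and "\<nu> \<le> 1"
    and "f \<in> mellin_orlicz (\<lambda>u. \<phi> u + \<eta> u) \<inter> log_lip \<eta> \<nu>"
  shows "\<exists>C>0. \<exists>c>0. \<forall>\<^sub>F w in at_top.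
           modular \<phi> (\<lambda>x. c * (exp_kantorovich t \<kappa> w f x - f x))
             \<le> ennreal (C * w powr (- Min {\<gamma> * \<nu>, \<gamma>\<^sub>0, \<alpha>}))"
proof -
  note ker = assms(3)
  have \<phi>0: "0 \<le> \<phi> \<bar>u\<bar>" and \<eta>0: "0 \<le> \<eta> \<bar>u\<bar>" for u
    using assms(4,6) by (auto simp: phi_function_def intro!: mono_on_nonneg[of \<phi>] mono_on_nonneg[of \<eta>])
  have \<gamma>: "0 < \<gamma>" "\<gamma> < 1" using assms(10) by auto
  obtain a where f: "f \<in> borel_measurable log_measure" and a: "0 < a"
      and fin: "modular (\<lambda>u. \<phi> u + \<eta> u) (\<lambda>x. a * f x) < \<infinity>"
    using assms(14) by (auto simp: mellin_orlicz_def)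
  \<comment> \<open>Both summands of \<open>\<phi> u + \<eta> u\<close> are nonnegative on the
    half-line, so one scale \<open>a\<close> serves for both modulars.\<close>
  have "modular \<phi> (\<lambda>x. a * f x) \<le> modular (\<lambda>u. \<phi> u + \<eta> u) (\<lambda>x. a * f x)"
    "modular \<eta> (\<lambda>x. a * f x) \<le> modular (\<lambda>u. \<phi> u + \<eta> u) (\<lambda>x. a * f x)"
    unfolding modular_def using \<phi>0 \<eta>0 by (auto intro!: nn_integral_mono ennreal_leI)
  with fin have fin': "modular \<phi> (\<lambda>x. a * f x) < \<infinity>" "modular \<eta> (\<lambda>x. a * f x) < \<infinity>"
    by (auto intro: le_less_trans)
  then obtain p q where p: "modular \<phi> (\<lambda>x. a * f x) = ennreal p" "0 \<le> p"
    and q: "modular \<eta> (\<lambda>x. a * f x) = ennreal q" "0 \<le> q"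
    by (cases "modular \<phi> (\<lambda>x. a * f x)"; cases "modular \<eta> (\<lambda>x. a * f x)") auto
  obtain b H' where b: "0 < b"
      and "\<forall>\<^sub>F \<delta> in at_right 0. log_modulus \<eta> (\<lambda>x. b * f x) \<delta> \<le> ennreal (H' * \<delta> powr \<nu>)"
    using assms(14) by (auto simp: log_lip_def)
  \<comment> \<open>The constant supplied by the class may be negative; a nonnegative one is needed
    for monotonicity in the power of \<open>w\<close>.\<close>
  moreover define H where "H = max 0 H'"
  moreover have "ennreal (H' * \<delta> powr \<nu>) \<le> ennreal (H * \<delta> powr \<nu>)" for \<delta>
    unfolding H_def by (intro ennreal_leI mult_right_mono) auto
  ultimately have lip: "\<forall>\<^sub>F \<delta> in at_right 0. log_modulus \<eta> (\<lambda>x. b * f x) \<delta> \<le> ennreal (H * \<delta> powr \<nu>)"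
    by (elim eventually_mono) (rule order.trans)
  have H: "0 \<le> H" by (simp add: H_def)
  obtain M where M: "1 \<le> M" "\<And>x A. 0 < x \<Longrightarrow> finite A \<Longrightarrow> (\<Sum>k\<in>A. L (exp (- t k) * x)) \<le> M"
    by (rule kernel_sum_bound[of t L \<beta>]) (use assms(2) ker in \<open>auto simp: starred_kernel_def\<close>)
  obtain K' where "\<forall>\<^sub>F w in at_top. \<forall>x>0. kernel_defect t \<kappa> w x \<le> ennreal (K' * w powr (- \<alpha>))"
    using ker by (auto simp: starred_kernel_def)
  moreover define K where "K = max 1 K'"
  moreover have "ennreal (K' * w powr (- \<alpha>)) \<le> ennreal (K * w powr (- \<alpha>))" for w
    unfolding K_def by (intro ennreal_leI mult_right_mono) auto
  ultimately have K_ev: "\<forall>\<^sub>F w in at_top. \<forall>x>0. kernel_defect t \<kappa> w x \<le> ennreal (K * w powr (- \<alpha>))"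
    by (elim eventually_mono) (blast intro: order.trans)
  have K: "0 < K" by (simp add: K_def)
  obtain E where E: "0 < E" and tail: "\<forall>\<^sub>F w in at_top.
      ennreal w * (\<integral>\<^sup>+y\<in>{y. 1 / w powr \<gamma> < \<bar>ln y\<bar>}. ennreal (L (y powr w)) \<partial>log_measure)
        \<le> ennreal (E * w powr (- \<gamma>\<^sub>0))"
    using assms(11) by (auto simp: kernel_tail_decay_def)
  have "(\<integral>\<^sup>+y. ennreal (L y) \<partial>log_measure) < \<infinity>"
  proof -
    have "(\<integral>\<^sup>+y. ennreal (L y) \<partial>log_measure) \<le> (\<integral>\<^sup>+y. ennreal (norm (L y)) \<partial>log_measure)"
      by (intro nn_integral_mono ennreal_leI) simp
    also have "\<dots> < \<infinity>" using ker by (simp add: starred_kernel_def integrable_iff_bounded)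
    finally show ?thesis .
  qed
  then obtain N where N: "(\<integral>\<^sup>+y. ennreal (L y) \<partial>log_measure) = ennreal N" "0 \<le> N"
    by (cases "\<integral>\<^sup>+y. ennreal (L y) \<partial>log_measure") auto
  \<comment> \<open>The entry \<open>1 / 2\<close> puts \<open>l\<close> into the open unit
    interval, where the comparison hypothesis supplies \<open>C\<close>; the other two leave room
    for the doublings.\<close>
  define l where "l = Min {1 / 2, a / 4, b / 2}"
  have l: "0 < l" "l < 1" "4 * l \<le> a" "2 * l \<le> b"
    using a b by (auto simp: l_def min_def)
  obtain C where C: "0 < C" "\<And>u. 0 \<le> u \<Longrightarrow> \<phi> (C * \<psi> u) \<le> \<eta> (l * u)"
    using assms(8)[of l] l by auto
  \<comment> \<open>The first entry serves the difference series, the second the defect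
    term.\<close>
  define c where "c = min (C / (2 * M)) (a / (2 * K))"
  have c: "0 < c" using C M(1) a K by (simp add: c_def)
  have "c \<le> C / (2 * M)" "c \<le> a / (2 * K)" by (simp_all add: c_def)
  then have c': "2 * c * M \<le> C" "2 * c * K \<le> a"
    using M(1) K by (simp_all add: field_simps)
  define e where "e = Min {\<gamma> * \<nu>, \<gamma>\<^sub>0, \<alpha>}"
  have e: "e \<le> \<gamma> * \<nu>" "e \<le> \<gamma>\<^sub>0" "e \<le> \<alpha>" by (simp_all add: e_def)
  \<comment> \<open>Shifts inside a cell contribute the exponent \<nu>, which is no worse than
    \<open>\<gamma> * \<nu>\<close> since \<gamma> is below 1.\<close>
  have e\<nu>: "e \<le> \<nu>" using e(1) mult_left_le_one_le[of \<nu> \<gamma>] \<gamma> assms(12) by linarith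
  \<comment> \<open>The log-Hoelder bound is known only near 0 and is used at two scales: the
    threshold \<open>1 / w powr \<gamma>\<close> for the shifts and the cell length
    \<open>1 / w\<close>.\<close>
  have lim: "filterlim (\<lambda>w::real. 1 / w powr \<gamma>) (at_right 0) at_top"
    "filterlim (\<lambda>w::real. 1 / w) (at_right 0) at_top"
  proof -
    have "((\<lambda>w::real. w powr (- \<gamma>)) \<longlongrightarrow> 0) at_top"
      using \<gamma> by (intro tendsto_neg_powr filterlim_ident) auto
    then show "filterlim (\<lambda>w::real. 1 / w powr \<gamma>) (at_right 0) at_top"
      by (intro tendsto_imp_filterlim_at_right eventually_mono[OF eventually_gt_at_top[of 0]])
        (auto simp: powr_minus_divide)
    show "filterlim (\<lambda>w::real. 1 / w) (at_right 0) at_top"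
      by (intro tendsto_imp_filterlim_at_right eventually_mono[OF eventually_gt_at_top[of 0]])
        (auto simp: divide_inverse intro: tendsto_inverse_0_at_top filterlim_ident)
  qed
  have "\<forall>\<^sub>F w in at_top. modular \<phi> (\<lambda>x. c * (exp_kantorovich t \<kappa> w f x - f x))
      \<le> ennreal ((p + N * H + 2 * q * E + M * H + 1) * w powr (- e))"
    using K_ev tail filterlim_iff[THEN iffD1, OF lim(1), rule_format, OF lip]
      filterlim_iff[THEN iffD1, OF lim(2), rule_format, OF lip] eventually_ge_at_top[of 1]
  proof eventually_elim
    case (elim w)
    have mono: "w powr (- d) \<le> w powr (- e)" if "e \<le> d" for d
      using elim(5) that by (intro powr_mono) auto
    have r1: "(1 / w powr \<gamma>) powr \<nu> = w powr (- (\<gamma> * \<nu>))" and r2: "(1 / w) powr \<nu> = w powr (- \<nu>)"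
      using elim(5) by (simp_all add: powr_divide powr_powr powr_minus_divide)
    have "modular \<phi> (\<lambda>x. c * (exp_kantorovich t \<kappa> w f x - f x))
      \<le> ennreal (w powr (- \<alpha>)) * ennreal p
        + ennreal N * log_modulus \<eta> (\<lambda>x. b * f x) (1 / w powr \<gamma>)
        + 2 * ennreal q *
          (ennreal w * (\<integral>\<^sup>+y\<in>{y. 1 / w powr \<gamma> < \<bar>ln y\<bar>}. ennreal (L (y powr w)) \<partial>log_measure))
        + ennreal M * log_modulus \<eta> (\<lambda>x. b * f x) (1 / w)"
      using exp_kantorovich_modular_le[OF assms(2) ker assms(4-7) f a fin'(2) l(1,3,4) C M K _ c c' elim(5)]
        elim(1) unfolding p(1) q(1) N(1) by blast
    also have "\<dots> \<le> ennreal (w powr (- e)) * ennreal p + ennreal N * ennreal (H * w powr (- e))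
        + 2 * ennreal q * ennreal (E * w powr (- e)) + ennreal M * ennreal (H * w powr (- e))"
    proof (intro add_mono mult_mono mult_left_mono)
      show "ennreal (w powr (- \<alpha>)) \<le> ennreal (w powr (- e))"
        using mono[OF e(3)] by (rule ennreal_leI)
      show "log_modulus \<eta> (\<lambda>x. b * f x) (1 / w powr \<gamma>) \<le> ennreal (H * w powr (- e))"
        using elim(3) mono[OF e(1)] H unfolding r1
        by (elim order.trans) (intro ennreal_leI mult_left_mono)
      show "ennreal w * (\<integral>\<^sup>+y\<in>{y. 1 / w powr \<gamma> < \<bar>ln y\<bar>}. ennreal (L (y powr w)) \<partial>log_measure)
          \<le> ennreal (E * w powr (- e))"
        using elim(2) mono[OF e(2)] E
        by (elim order.trans) (intro ennreal_leI mult_left_mono, auto)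
      show "log_modulus \<eta> (\<lambda>x. b * f x) (1 / w) \<le> ennreal (H * w powr (- e))"
        using elim(4) mono[OF e\<nu>] H unfolding r2
        by (elim order.trans) (intro ennreal_leI mult_left_mono)
    qed auto
    also have "\<dots> = ennreal ((p + N * H + 2 * q * E + M * H) * w powr (- e))"
    proof -
      have "2 * ennreal q = ennreal (2 * q)" using q by (simp add: ennreal_mult)
      then show ?thesis
        using p q N H E M(1)
        by (simp add: ennreal_mult[symmetric] ennreal_plus[symmetric] algebra_simps del: ennreal_plus)
    qed
    \<comment> \<open>The added 1 keeps the constant positive even if all other summands
      vanish.\<close>
    also have "\<dots> \<le> ennreal ((p + N * H + 2 * q * E + M * H + 1) * w powr (- e))"
      by (intro ennreal_leI mult_right_mono) auto
    finally show ?case .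
  qed
  moreover have "0 < p + N * H + 2 * q * E + M * H + 1"
    using p q N H E M(1) by (intro add_nonneg_pos add_nonneg_nonneg mult_nonneg_nonneg) auto
  ultimately show ?thesis using c unfolding e_def by blast
qed

end
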